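(* Let $X$ be a Banach space and let $T,K\in B[X]$. Suppose $T$ is bounded below, $\overline{\mathcal R(T)}$ is a complemented subspace of $X$, and $K$ is compact. Then $\overline{\mathcal R(T+K)}$ and $\mathcal N(T+K)$ are complemented subspaces of $X$, $\overline{\mathcal R(T^*+K^* )}$ and $\mathcal N(T^*+K^* )$ are complemented subspaces of $X^*$, $\mathcal R(T+K)$ is closed in $X$, and $\mathcal R(T^*+K^* )$ is closed in $X^*$.
   Context: For a normed space $Y$, $B[Y]$ is the algebra of bounded linear operators on $Y$; a subspace of $Y$ means a norm-closed linear manifold of $Y$. A subspace $M$ of $Y$ is complemented in $Y$ if there is a subspace (norm-closed linear manifold) $N$ of $Y$ with $M+N=Y$ and $M\cap N=\{0\}$. For an operator $S$, $\mathcal R(S)$ and $\mathcal N(S)$ denote its range and kernel, and $\overline{\mathcal R(S)}$ is the norm closure of the range. $X^*$ is the (norm) dual of $X$, and the normed-space adjoint $T^*\in B[X^*]$ of $T\in B[X]$ is given by $T^*f=f\circ T$. An operator $T\in B[X]$ is bounded below if there is $\alpha>0$ such that $\alpha\|x\|\le\|Tx\|$ for all $x\in X$. *)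

theory Defs
  imports "HOL-Analysis.Analysis"
begin

text \<open>
  Normed spaces are over the real or the complex field. The type class
  \<^class>\<open>real_normed_vector\<close> supplies the norm and the topology, and the locale below adds a
  scalar multiplication by \<open>'k\<close> extending the real one. By Gelfand--Mazur,
  \<^typ>\<open>real\<close> and \<^typ>\<open>complex\<close> are, up to isometric isomorphism, the only instances of
  \<^class>\<open>real_normed_field\<close>. If \<open>'k\<close> is \<^typ>\<open>real\<close>, the scalar multiplication is necessarily
  \<^const>\<open>scaleR\<close>.
\<close>

locale normed_space = vector_space smul
  for smul :: "'k::real_normed_field \<Rightarrow> 'a::real_normed_vector \<Rightarrow> 'a" +
  assumes scale_of_real: "smul (of_real r) x = r *\<^sub>R x"
    and norm_scale: "norm (smul c x) = norm c * norm x"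

definition bounded_ops :: "('k::real_normed_field \<Rightarrow> 'a::real_normed_vector \<Rightarrow> 'a) \<Rightarrow> ('a \<Rightarrow>\<^sub>L 'a) set"
  where "bounded_ops smul = {T. Vector_Spaces.linear smul smul (blinfun_apply T)}"

text \<open>
  The dual space is a subset of the type of bounded real-linear maps into the scalars, since
  \<open>'k\<close>-linearity depends on the scalar multiplication. The norm is the operator norm of that type.
  Because the dual is not a type, the notions below are relative to a carrier \<open>Y\<close>.
\<close>

definition dual :: "('k::real_normed_field \<Rightarrow> 'a::real_normed_vector \<Rightarrow> 'a) \<Rightarrow> ('a \<Rightarrow>\<^sub>L 'k) set"
  where "dual smul = {f. Vector_Spaces.linear smul (*) (blinfun_apply f)}"

definition dual_scale :: "'k::real_normed_field \<Rightarrow> ('a::real_normed_vector \<Rightarrow>\<^sub>L 'k) \<Rightarrow> ('a \<Rightarrow>\<^sub>L 'k)"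
  where "dual_scale c f = Blinfun (\<lambda>x. c * f x)"

definition normed_adjoint ::
    "('a::real_normed_vector \<Rightarrow>\<^sub>L 'a) \<Rightarrow> ('a \<Rightarrow>\<^sub>L 'k::real_normed_field) \<Rightarrow> ('a \<Rightarrow>\<^sub>L 'k)"
  where "normed_adjoint T f = f o\<^sub>L T"

definition closed_subspace ::
    "('k::real_normed_field \<Rightarrow> 'y::real_normed_vector \<Rightarrow> 'y) \<Rightarrow> 'y set \<Rightarrow> 'y set \<Rightarrow> bool"
  where "closed_subspace smul Y M \<longleftrightarrow>
    M \<subseteq> Y \<and> module.subspace smul M \<and> closedin (top_of_set Y) M"

definition complemented ::
    "('k::real_normed_field \<Rightarrow> 'y::real_normed_vector \<Rightarrow> 'y) \<Rightarrow> 'y set \<Rightarrow> 'y set \<Rightarrow> bool"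
  where "complemented smul Y M \<longleftrightarrow>
    closed_subspace smul Y M \<and>
    (\<exists>N. closed_subspace smul Y N \<and> {m + n |m n. m \<in> M \<and> n \<in> N} = Y \<and> M \<inter> N = {0})"

definition kernel_on :: "'y set \<Rightarrow> ('y \<Rightarrow> 'z::zero) \<Rightarrow> 'y set"
  where "kernel_on Y S = {y \<in> Y. S y = 0}"

definition bounded_below :: "('a::real_normed_vector \<Rightarrow>\<^sub>L 'a) \<Rightarrow> bool"
  where "bounded_below T \<longleftrightarrow> (\<exists>\<alpha>>0. \<forall>x. \<alpha> * norm x \<le> norm (T x))"

definition compact_operator :: "('a::real_normed_vector \<Rightarrow>\<^sub>L 'a) \<Rightarrow> bool"
  where "compact_operator K \<longleftrightarrow> (\<forall>B. bounded B \<longrightarrow> compact (closure (blinfun_apply K ` B)))"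

lemma normed_space_scaleR: "normed_space (scaleR :: real \<Rightarrow> 'a::real_normed_vector \<Rightarrow> 'a)"
  by unfold_locales (auto simp: scaleR_add_right scaleR_add_left)

lemma normed_space_mult: "normed_space ((*) :: 'k::real_normed_field \<Rightarrow> 'k \<Rightarrow> 'k)"
  by unfold_locales (auto simp: algebra_simps norm_mult scaleR_conv_of_real)

lemma dual_scale_apply [simp]: "blinfun_apply (dual_scale c f) x = c * blinfun_apply f x"
  unfolding dual_scale_def
  by (subst bounded_linear_Blinfun_apply)
    (auto intro: bounded_linear_const_mult blinfun.bounded_linear_right)

lemma norm_dual_scale: "norm (dual_scale c f) = norm c * norm f"
proof (rule antisym)
  have le: "norm (dual_scale d g) \<le> norm d * norm g" for d :: 'b and g :: "'a \<Rightarrow>\<^sub>L 'b"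
    by (rule norm_blinfun_bound)
      (auto simp: norm_mult mult.assoc intro!: mult_left_mono norm_blinfun)
  then show "norm (dual_scale c f) \<le> norm c * norm f" .
  show "norm c * norm f \<le> norm (dual_scale c f)"
  proof (cases "c = 0")
    case False
    have "f = dual_scale (inverse c) (dual_scale c f)"
      using False by (intro blinfun_eqI) simp
    then have "norm f \<le> norm (inverse c) * norm (dual_scale c f)"
      by (metis le)
    then show ?thesis
      using False by (simp add: norm_inverse norm_divide divide_simps mult.commute)
  qed simp
qed

lemma normed_space_dual_scale:
  "normed_space (dual_scale :: 'k::real_normed_field \<Rightarrow> ('a::real_normed_vector \<Rightarrow>\<^sub>L 'k) \<Rightarrow> _)"
  by unfold_locales
    (auto intro!: blinfun_eqI simp: norm_dual_scale blinfun.add_left blinfun.scaleR_left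
      algebra_simps scaleR_conv_of_real)

lemma (in normed_space) linear_iff:
  assumes "normed_space s"
  shows "Vector_Spaces.linear smul s f \<longleftrightarrow>
    (\<forall>x y. f (x + y) = f x + f y) \<and> (\<forall>c x. f (smul c x) = s c (f x))"
proof -
  interpret S: normed_space s
    by (rule assms)
  show ?thesis
    using vector_space_axioms S.vector_space_axioms module_axioms S.module_axioms
    by (auto simp: Vector_Spaces.linear_def module_hom_def module_hom_axioms_def)
qed

lemma (in normed_space) closed_subspace_dual: "closed_subspace dual_scale (dual smul) (dual smul)"
proof -
  interpret D: normed_space "dual_scale :: 'k \<Rightarrow> ('a \<Rightarrow>\<^sub>L 'k) \<Rightarrow> _"
    by (rule normed_space_dual_scale)
  have "D.subspace (dual smul)"
    unfolding D.subspace_def dual_def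
    by (auto simp: linear_iff[OF normed_space_mult] blinfun.add_left blinfun.zero_left algebra_simps)
  then show ?thesis
    by (simp add: closed_subspace_def)
qed

lemma (in normed_space) closed_dual: "closed (dual smul)"
proof -
  have "dual smul = (\<Inter>c x. {f. blinfun_apply f (smul c x) = c * blinfun_apply f x})"
    unfolding dual_def linear_iff[OF normed_space_mult] by (auto simp: blinfun.add_right)
  also have "closed \<dots>"
    by (intro closed_INT ballI closed_Collect_eq continuous_intros)
  finally show ?thesis .
qed

lemma (in normed_space) normed_adjoint_dual:
  assumes "T \<in> bounded_ops smul" and "f \<in> dual smul"
  shows "normed_adjoint T f \<in> dual smul"
proof -
  show ?thesis
    using assms
    by (simp add: dual_def bounded_ops_def normed_adjoint_def linear_iff[OF normed_space_mult] linear_iff[OF normed_space_axioms])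
qed

end

theory Submission
  imports Defs
begin

text \<open>
  Write \<open>A = T + K\<close>. All six assertions follow from one fact: there is a bounded linear \<open>D\<close> with
  \<open>A D A = A\<close>, an inner inverse of \<open>A\<close>. Then \<open>A D\<close> is a bounded projection with the range of \<open>A\<close>,
  and \<open>D A\<close> is a bounded projection with the kernel of \<open>A\<close>, and the range and the kernel of a
  bounded projection are closed complements of each other. Passing to adjoints turns the identity
  into \<open>A\<^sup>* D\<^sup>* A\<^sup>* = A\<^sup>*\<close>, so the same argument works on the dual space.

  To find \<open>D\<close>, start with a left inverse \<open>L\<close> of \<open>T\<close>: the range of \<open>T\<close> has a closed complement, and in
  a Banach space the projection along a closed complement is bounded
  (\<open>closed_complements_bounded\<close>). Then \<open>L A = 1 + C\<close> with \<open>C = L K\<close> compact. By Riesz theory,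
  \<open>1 + C\<close> has a finite-dimensional kernel, and it is injective if and only if it is surjective.
  Therefore finitely many corrections by operators of rank one, each of which maps a kernel vector
  to a vector outside the range, lead to a finite-rank \<open>P\<close> with \<open>1 + C + P\<close> invertible
  (\<open>finite_rank_injective_correction\<close>). If \<open>V\<close> is its inverse, then \<open>V L A = 1 - V P\<close>, so
  \<open>V L\<close> fails to be an inner inverse of \<open>A\<close> only by the finite-rank operator
  \<open>A - A (V L) A = A V P\<close>. Von Neumann's lemma (\<open>inner_invertible_remainder\<close>) says that \<open>A\<close> has
  an inner inverse as soon as such a remainder has one, and the same lemma settles finite-rank
  operators by induction on the rank (\<open>finite_rank_inner_invertible\<close>).

  The rank-one operators are built from continuous linear functionals with a prescribed nonzero
  value. Over the reals these come from the Hahn--Banach theorem. They enter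
  when \<open>1 + C\<close> has a kernel vector \<open>x \<noteq> 0\<close>. In that case the scalar field embeds into the
  finite-dimensional kernel by \<open>c \<mapsto> c x\<close> and is therefore finite-dimensional over the reals,
  which allows real functionals to be converted into functionals over the scalar field without
  a case distinction between real and complex scalars.
\<close>

section \<open>Real functionals from minimal sublinear functionals\<close>

text \<open>
  Homogeneity is only demanded as an inequality, because that is the half which has to be checked
  for the infima below; the equation follows by applying it to \<open>t\<close> and to \<open>1/t\<close>.
\<close>

definition sublinear :: "('a::real_vector \<Rightarrow> real) \<Rightarrow> bool"
  where "sublinear q \<longleftrightarrow>
    (\<forall>x y. q (x + y) \<le> q x + q y) \<and> (\<forall>t>0. \<forall>x. q (t *\<^sub>R x) \<le> t * q x)"

lemma sublinearD:
  assumes "sublinear q"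
  shows "q (x + y) \<le> q x + q y" and "0 \<le> t \<Longrightarrow> q (t *\<^sub>R x) = t * q x" and "q 0 = 0"
    and "- q (- x) \<le> q x"
proof -
  show add: "q (x + y) \<le> q x + q y" for x y
    using assms by (auto simp: sublinear_def)
  have le: "q (t *\<^sub>R x) \<le> t * q x" if "t > 0" for t x
    using assms that by (auto simp: sublinear_def)
  show zero: "q 0 = 0"
    using le[of 2 0] le[of "1/2" 0] by simp
  show "q (t *\<^sub>R x) = t * q x" if "t \<ge> 0"
  proof (cases "t = 0")
    case True
    with zero show ?thesis by simp
  next
    case False
    with that have t: "t > 0" by simp
    have "q x \<le> inverse t * q (t *\<^sub>R x)"
      using le[of "inverse t" "t *\<^sub>R x"] t by simp
    then have "t * q x \<le> q (t *\<^sub>R x)"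
      using t by (simp add: field_simps)
    with le[OF t, of x] show ?thesis by simp
  qed
  show "- q (- x) \<le> q x"
    using add[of x "- x"] zero by simp
qed

text \<open>
  Lowering a sublinear functional as far as possible in the direction \<open>x\<close>: the new functional lies
  below the old one (take \<open>t = 0\<close>), and its value at \<open>- x\<close> is at most \<open>- q x\<close> (take \<open>t = 1\<close>).
\<close>

lemma sublinear_directional:
  fixes q :: "'a::real_vector \<Rightarrow> real" and x :: 'a
  assumes q: "sublinear q"
  defines "q' \<equiv> \<lambda>y. INF t\<in>{0..}. q (y + t *\<^sub>R x) - t * q x"
  shows "sublinear q'" and "t \<ge> 0 \<Longrightarrow> q' y \<le> q (y + t *\<^sub>R x) - t * q x"
proof -
  have "- q (- y) \<le> q (y + t *\<^sub>R x) - t * q x" if "t \<ge> 0" for t y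
    using sublinearD(1)[OF q, of "- y" "y + t *\<^sub>R x"] sublinearD(2)[OF q that, of x] by simp
  then have bdd: "bdd_below ((\<lambda>t. q (y + t *\<^sub>R x) - t * q x) ` {0..})" for y
    by (intro bdd_belowI2[where m = "- q (- y)"]) simp
  show lower: "q' y \<le> q (y + t *\<^sub>R x) - t * q x" if "t \<ge> 0" for y t
    unfolding q'_def by (rule cINF_lower[OF bdd]) (use that in simp)
  have greatest: "z \<le> q' y" if "\<And>t. t \<ge> 0 \<Longrightarrow> z \<le> q (y + t *\<^sub>R x) - t * q x" for y z
    unfolding q'_def by (rule cINF_greatest) (use that in auto)
  have "q' (y + z) \<le> q' y + q' z" for y z
  proof -
    have "q' (y + z) - (q (y + s *\<^sub>R x) - s * q x) \<le> q (z + t *\<^sub>R x) - t * q x"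
      if "s \<ge> 0" "t \<ge> 0" for s t
    proof -
      have "q' (y + z) \<le> q ((y + z) + (s + t) *\<^sub>R x) - (s + t) * q x"
        using that by (intro lower) simp
      also have "(y + z) + (s + t) *\<^sub>R x = (y + s *\<^sub>R x) + (z + t *\<^sub>R x)"
        by (simp add: algebra_simps)
      finally show ?thesis
        using sublinearD(1)[OF q, of "y + s *\<^sub>R x" "z + t *\<^sub>R x"] by (simp add: algebra_simps)
    qed
    then have "q' (y + z) - (q (y + s *\<^sub>R x) - s * q x) \<le> q' z" if "s \<ge> 0" for s
      using that by (intro greatest)
    then have "q' (y + z) - q' z \<le> q (y + s *\<^sub>R x) - s * q x" if "s \<ge> 0" for s
      using that by (smt (verit))
    then have "q' (y + z) - q' z \<le> q' y"
      by (intro greatest)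
    then show ?thesis by simp
  qed
  moreover have "q' (c *\<^sub>R y) \<le> c * q' y" if c: "c > 0" for c y
  proof -
    have "q' (c *\<^sub>R y) / c \<le> q (y + t *\<^sub>R x) - t * q x" if "t \<ge> 0" for t
    proof -
      have "q' (c *\<^sub>R y) \<le> q (c *\<^sub>R y + (c * t) *\<^sub>R x) - (c * t) * q x"
        using that c by (intro lower) simp
      also have "c *\<^sub>R y + (c * t) *\<^sub>R x = c *\<^sub>R (y + t *\<^sub>R x)"
        by (simp add: algebra_simps)
      also have "q \<dots> = c * q (y + t *\<^sub>R x)"
        using c by (intro sublinearD(2)[OF q]) simp
      finally show ?thesis
        using c by (simp add: field_simps)
    qed
    then have "q' (c *\<^sub>R y) / c \<le> q' y"
      by (rule greatest)
    then show ?thesis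
      using c by (simp add: field_simps)
  qed
  ultimately show "sublinear q'"
    by (simp add: sublinear_def)
qed

text \<open>
  Zorn's lemma: the pointwise infimum of a chain of sublinear functionals below \<open>p\<close> is finite because
  each of them is bounded below by \<open>- p (- x)\<close> at \<open>x\<close>.
\<close>

lemma minimal_sublinear_exists:
  fixes p :: "'a::real_vector \<Rightarrow> real"
  assumes p: "sublinear p"
  obtains q where "sublinear q" "q \<le> p" "\<And>q'. sublinear q' \<Longrightarrow> q' \<le> q \<Longrightarrow> q' = q"
proof -
  define A where "A = {q. sublinear q \<and> q \<le> p}"
  have "\<exists>m\<in>A. \<forall>a\<in>A. m \<ge> a \<longrightarrow> a = m"
  proof (rule predicate_Zorn)
    show "partial_order_on A (relation_of (\<ge>) A)"
      by (rule partial_order_on_relation_ofI) auto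
    fix C assume "C \<in> Chains (relation_of (\<ge>) A)"
    then have CA: "\<And>q. q \<in> C \<Longrightarrow> q \<in> A" and chain: "\<And>q r. q \<in> C \<Longrightarrow> r \<in> C \<Longrightarrow> q \<le> r \<or> r \<le> q"
      by (auto simp: Chains_def relation_of_def)
    show "\<exists>u\<in>A. \<forall>a\<in>C. u \<le> a"
    proof (cases "C = {}")
      case True
      with p show ?thesis by (auto simp: A_def)
    next
      case False
      define u where "u x = (INF q\<in>C. q x)" for x
      have "- p (- x) \<le> q x" if "q \<in> C" for q x
        using CA[OF that] sublinearD(4)[of q x] by (smt (verit) A_def le_funD mem_Collect_eq)
      then have "bdd_below ((\<lambda>q. q x) ` C)" for x
        by (intro bdd_belowI2)
      then have lower: "u x \<le> q x" if "q \<in> C" for q x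
        unfolding u_def using that by (intro cINF_lower)
      have greatest: "z \<le> u x" if "\<And>q. q \<in> C \<Longrightarrow> z \<le> q x" for x z
        unfolding u_def by (rule cINF_greatest) (use that False in auto)
      have "u (x + y) \<le> u x + u y" for x y
      proof -
        have "u (x + y) - q x \<le> r y" if qr: "q \<in> C" "r \<in> C" for q r
        proof -
          obtain s where s: "s \<in> C" "s \<le> q" "s \<le> r"
            using chain[OF qr] qr by auto
          then have "u (x + y) \<le> s x + s y"
            using lower[OF s(1), of "x + y"] CA[OF s(1)] sublinearD(1)[of s x y] by (simp add: A_def)
          then show ?thesis
            using s(2,3) by (smt (verit) le_funD)
        qed
        then have "u (x + y) - q x \<le> u y" if "q \<in> C" for q
          using that by (intro greatest)
        then have "u (x + y) - u y \<le> q x" if "q \<in> C" for q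
          using that by (smt (verit))
        then have "u (x + y) - u y \<le> u x"
          by (intro greatest)
        then show ?thesis by simp
      qed
      moreover have "u (c *\<^sub>R x) \<le> c * u x" if c: "c > 0" for c x
      proof -
        have "u (c *\<^sub>R x) / c \<le> q x" if "q \<in> C" for q
          using lower[OF that, of "c *\<^sub>R x"] CA[OF that] sublinearD(2)[of q c x] c
          by (simp add: A_def field_simps)
        then have "u (c *\<^sub>R x) / c \<le> u x"
          by (rule greatest)
        then show ?thesis
          using c by (simp add: field_simps)
      qed
      moreover have "u \<le> p"
      proof -
        obtain q where "q \<in> C" using False by auto
        then show ?thesis
          using CA[of q] lower[of q] by (force simp: A_def le_fun_def intro: order_trans)
      qed
      ultimately have "u \<in> A"
        by (simp add: A_def sublinear_def)
      with lower show ?thesis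
        by (auto simp: le_fun_def)
    qed
  qed
  then obtain m where "m \<in> A" and "\<And>a. a \<in> A \<Longrightarrow> a \<le> m \<Longrightarrow> a = m"
    by blast
  then show ?thesis
    by (intro that[of m]) (auto simp: A_def intro: order_trans)
qed

text \<open>
  A minimal functional cannot be lowered in any direction \<open>x\<close>, and for \<open>t = 1\<close> this is the reverse
  of the triangle inequality.
\<close>

lemma minimal_sublinear_linear:
  fixes q :: "'a::real_vector \<Rightarrow> real"
  assumes q: "sublinear q" and min: "\<And>q'. sublinear q' \<Longrightarrow> q' \<le> q \<Longrightarrow> q' = q"
  shows "linear q"
proof -
  have add: "q (y + x) = q y + q x" for x y
  proof -
    define q' where "q' y = (INF t\<in>{0..}. q (y + t *\<^sub>R x) - t * q x)" for y
    have "q' \<le> q"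
      using sublinear_directional(2)[OF q, of 0 _ x] by (simp add: le_fun_def q'_def)
    then have "q' = q"
      using sublinear_directional(1)[OF q, of x] by (intro min) (simp_all add: q'_def[abs_def])
    then have "q y \<le> q (y + x) - q x"
      using sublinear_directional(2)[OF q, of 1 y x] by (simp add: q'_def[symmetric])
    with sublinearD(1)[OF q, of y x] show ?thesis by simp
  qed
  have minus: "q (- x) = - q x" for x
    using add[of x "- x"] sublinearD(3)[OF q] by simp
  have "q (t *\<^sub>R x) = t * q x" for t x
  proof (cases "t \<ge> 0")
    case False
    then show ?thesis
      using sublinearD(2)[OF q, of "- t" x] minus[of "t *\<^sub>R x"] by simp
  qed (rule sublinearD(2)[OF q])
  with add show ?thesis
    by (intro linearI) simp_all
qed

text \<open>
  The Hahn--Banach theorem in the form that is used below: start from the norm, lower it in the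
  direction of \<open>x\<close> so that the value at \<open>- x\<close> is at most \<open>- norm x\<close>, and take a minimal sublinear
  functional below the result.
\<close>

theorem real_functional_nonzero:
  fixes x :: "'a::real_normed_vector"
  assumes "x \<noteq> 0"
  obtains u :: "'a \<Rightarrow>\<^sub>L real" where "u x \<noteq> 0"
proof -
  define p where "p y = (INF t\<in>{0..}. norm (y + t *\<^sub>R x) - t * norm x)" for y
  have n: "sublinear (norm :: 'a \<Rightarrow> real)"
    by (simp add: sublinear_def norm_triangle_ineq)
  have p: "sublinear p"
    using sublinear_directional(1)[OF n, of x] by (simp add: p_def[abs_def])
  obtain q where q: "sublinear q" "q \<le> p" and min: "\<And>q'. sublinear q' \<Longrightarrow> q' \<le> q \<Longrightarrow> q' = q"
    using minimal_sublinear_exists[OF p] by blast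
  have lin: "linear q"
    using q(1) min by (rule minimal_sublinear_linear)
  have qn: "q y \<le> norm y" for y
    using le_funD[OF q(2), of y] sublinear_directional(2)[OF n, of 0 y x] by (simp add: p_def)
  have "norm (q y) \<le> norm y * 1" for y
    using qn[of y] qn[of "- y"] by (simp add: linear_neg[OF lin])
  then have bl: "bounded_linear q"
    using lin by (intro bounded_linear_intro[where K = 1]) (simp_all add: linear_add linear_scale)
  have "q (- x) \<le> - norm x"
    using le_funD[OF q(2), of "- x"] sublinear_directional(2)[OF n, of 1 "- x" x] by (simp add: p_def)
  then have "norm x \<le> q x"
    by (simp add: linear_neg[OF lin])
  then have "q x \<noteq> 0"
    using assms by (smt (verit) zero_less_norm_iff)
  then show ?thesis
    using that[of "Blinfun q"] bl by (simp add: bounded_linear_Blinfun_apply)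
qed

section \<open>Closed complements in Banach spaces\<close>

lemma Baire_closed_cover:
  fixes E :: "nat \<Rightarrow> 'a::banach set"
  assumes "\<And>j. closed (E j)" and "(\<Union>j. E j) = UNIV"
  obtains j where "interior (E j) \<noteq> {}"
proof -
  have "\<exists>j. interior (E j) \<noteq> {}"
  proof (rule ccontr)
    assume "\<nexists>j. interior (E j) \<noteq> {}"
    then have "euclidean interior_of \<Union>(range E) = {}"
      using assms(1)
      by (intro Baire_category_alt) (auto simp: completely_metrizable_space_euclidean complete_UNIV)
    with assms(2) show False by simp
  qed
  with that show ?thesis by blast
qed

text \<open>
  The approximate half of the open mapping argument for the addition map from \<open>M \<times> N\<close>. By the Baire
  category theorem, the closure of the set of sums with first summand of norm at most \<open>j\<close> has an
  interior point for some \<open>j\<close>. As this set is convex and symmetric, its closure contains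
  a ball around the origin.
\<close>

lemma closed_complements_approximation:
  fixes M N :: "'a::banach set"
  assumes M: "subspace M" and N: "subspace N"
    and sum: "\<And>x. \<exists>m\<in>M. \<exists>n\<in>N. x = m + n"
  obtains c where "c \<ge> 0"
    "\<And>x. \<exists>m\<in>M. \<exists>n\<in>N. norm m \<le> c * norm x \<and> norm (x - m - n) \<le> norm x / 2"
proof -
  define D where "D j = {m + n |m n. m \<in> M \<and> n \<in> N \<and> norm m \<le> j}" for j :: real
  have "x \<in> (\<Union>j. closure (D (real j)))" for x
  proof -
    obtain m n where mn: "m \<in> M" "n \<in> N" "x = m + n" using sum by blast
    obtain j :: nat where "norm m \<le> j" using real_arch_simple by blast
    with mn have "x \<in> D j" by (auto simp: D_def)
    then show ?thesis using closure_subset by blast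
  qed
  then have "(\<Union>j. closure (D (real j))) = UNIV"
    by blast
  then obtain j :: nat where "interior (closure (D j)) \<noteq> {}"
    by (rule Baire_closed_cover[OF closed_closure])
  then obtain x0 e where e: "e > 0" "ball x0 e \<subseteq> closure (D j)"
    by (metis equals0I mem_interior)
  have approx: "\<exists>d\<in>D j. norm (x - d) < e'" if "x \<in> closure (D j)" "e' > 0" for x e'
    using that by (metis closure_approachable dist_commute dist_norm)
  have near: "\<exists>m\<in>M. \<exists>n\<in>N. norm m \<le> j \<and> norm (h - m - n) \<le> e / 4" if h: "norm h < e" for h
  proof -
    have "x0 + h \<in> closure (D j)" "x0 - h \<in> closure (D j)"
      using e(2) h by (auto simp: dist_norm subset_iff)
    then obtain d d' where d: "d \<in> D j" "norm (x0 + h - d) < e / 4"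
      and d': "d' \<in> D j" "norm (x0 - h - d') < e / 4"
      using approx[of _ "e / 4"] e(1) by (meson divide_pos_pos zero_less_numeral)
    obtain m n m' n' where mn: "m \<in> M" "n \<in> N" "d = m + n" "norm m \<le> j"
      and mn': "m' \<in> M" "n' \<in> N" "d' = m' + n'" "norm m' \<le> j"
      using d(1) d'(1) by (auto simp: D_def)
    have "(1/2) *\<^sub>R (m - m') \<in> M" "(1/2) *\<^sub>R (n - n') \<in> N"
      using mn mn' M N by (auto intro!: subspace_scale subspace_diff)
    moreover have "norm ((1/2) *\<^sub>R (m - m')) \<le> j"
      using norm_triangle_ineq4[of m m'] mn mn' by simp
    moreover have "norm (h - (1/2) *\<^sub>R (m - m') - (1/2) *\<^sub>R (n - n')) \<le> e / 4"
    proof -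
      have "h - (1/2) *\<^sub>R (m - m') - (1/2) *\<^sub>R (n - n')
          = (1/2) *\<^sub>R ((x0 + h - d) - (x0 - h - d'))"
        by (simp add: mn(3) mn'(3) algebra_simps flip: scaleR_add_left)
      also have "norm \<dots> = (1/2) * norm ((x0 + h - d) - (x0 - h - d'))"
        by simp
      finally show ?thesis
        using norm_triangle_ineq4[of "x0 + h - d" "x0 - h - d'"] d(2) d'(2) by linarith
    qed
    ultimately show ?thesis by blast
  qed
  show ?thesis
  proof (rule that[of "2 * real j / e"])
    show "0 \<le> 2 * real j / e" using e by simp
    fix x
    show "\<exists>m\<in>M. \<exists>n\<in>N. norm m \<le> 2 * real j / e * norm x \<and> norm (x - m - n) \<le> norm x / 2"
    proof (cases "x = 0")
      case True
      then show ?thesis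
        using subspace_0[OF M] subspace_0[OF N] by (intro bexI[of _ 0]) auto
    next
      case False
      \<comment> \<open>Rescales \<open>x\<close> to norm \<open>e / 2\<close>, inside the ball treated by \<open>near\<close>.\<close>
      define t where "t = 2 * norm x / e"
      have t: "t > 0" using False e by (simp add: t_def)
      have "norm ((1/t) *\<^sub>R x) = e / 2"
        using False e by (simp add: t_def)
      then have "norm ((1/t) *\<^sub>R x) < e"
        using e by simp
      then obtain m n where mn: "m \<in> M" "n \<in> N" "norm m \<le> j" "norm ((1/t) *\<^sub>R x - m - n) \<le> e / 4"
        using near by blast
      have "x - t *\<^sub>R m - t *\<^sub>R n = t *\<^sub>R ((1/t) *\<^sub>R x - m - n)"
        using t by (simp add: algebra_simps)
      then have "norm (x - t *\<^sub>R m - t *\<^sub>R n) = t * norm ((1/t) *\<^sub>R x - m - n)"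
        using t by simp
      also have "\<dots> \<le> t * (e / 4)"
        using t mn(4) by (intro mult_left_mono) auto
      also have "\<dots> = norm x / 2"
        using e by (simp add: t_def)
      finally have "norm (x - t *\<^sub>R m - t *\<^sub>R n) \<le> norm x / 2" .
      moreover have "norm (t *\<^sub>R m) \<le> t * j"
        using t mn(3) by simp
      then have "norm (t *\<^sub>R m) \<le> 2 * real j / e * norm x"
        by (simp add: t_def mult_ac)
      ultimately show ?thesis
        using subspace_scale[OF M mn(1)] subspace_scale[OF N mn(2)] by blast
    qed
  qed
qed

text \<open>
  The projection onto \<open>M\<close> along \<open>N\<close> is bounded. Iterating the approximation on the remainders
  writes \<open>x\<close> as a sum of a series in \<open>M\<close>, dominated by a geometric series, and a series in \<open>N\<close>;
  as the decomposition is unique, the first sum is the \<open>M\<close>-component of \<open>x\<close>.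
\<close>

theorem closed_complements_bounded:
  fixes M N :: "'a::banach set"
  assumes M: "subspace M" "closed M" and N: "subspace N" "closed N"
    and sum: "\<And>x. \<exists>m\<in>M. \<exists>n\<in>N. x = m + n" and int: "M \<inter> N = {0}"
  obtains c where "\<forall>m\<in>M. \<forall>n\<in>N. norm m \<le> c * norm (m + n)"
proof -
  obtain c where c: "c \<ge> 0"
    "\<And>x. \<exists>m\<in>M. \<exists>n\<in>N. norm m \<le> c * norm x \<and> norm (x - m - n) \<le> norm x / 2"
    using closed_complements_approximation[OF M(1) N(1) sum] by metis
  then obtain f g where fg: "\<And>x. f x \<in> M" "\<And>x. g x \<in> N" "\<And>x. norm (f x) \<le> c * norm x"
    "\<And>x. norm (x - f x - g x) \<le> norm x / 2"
    by metis
  have "norm m \<le> 2 * c * norm (m + n)" if mn: "m \<in> M" "n \<in> N" for m n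
  proof -
    define x where "x = m + n"
    define r where "r k = ((\<lambda>y. y - f y - g y) ^^ k) x" for k
    have r0: "r 0 = x" and r: "r (Suc k) = r k - f (r k) - g (r k)" for k
      by (simp_all add: r_def)
    have rn: "norm (r k) \<le> norm x * (1/2)^k" for k
    proof (induction k)
      case (Suc k)
      have "norm (r (Suc k)) \<le> norm (r k) / 2"
        unfolding r by (rule fg(4))
      with Suc show ?case by simp
    qed (simp add: r0)
    have fn: "norm (f (r k)) \<le> c * norm x * (1/2)^k" for k
      using fg(3)[of "r k"] mult_left_mono[OF rn[of k] c(1)] by (simp add: mult_ac)
    have geo: "(\<lambda>k. c * norm x * (1/2::real)^k) sums (c * norm x * 2)"
      using sums_mult[OF geometric_sums[of "1/2::real"], of "c * norm x"] by simp
    have sf: "summable (\<lambda>k. norm (f (r k)))"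
      by (rule summable_comparison_test'[OF sums_summable[OF geo]]) (use fn in simp)
    define m' where "m' = (\<Sum>k. f (r k))"
    have lim_m: "(\<lambda>k. \<Sum>i<k. f (r i)) \<longlonglongrightarrow> m'"
      unfolding m'_def using summable_LIMSEQ[OF summable_norm_cancel[OF sf]] .
    have "r \<longlonglongrightarrow> 0"
    proof (rule Lim_null_comparison)
      show "\<forall>\<^sub>F k in sequentially. norm (r k) \<le> norm x * (1/2)^k"
        using rn by simp
      show "(\<lambda>k. norm x * (1/2)^k) \<longlonglongrightarrow> 0"
        by (intro tendsto_mult_right_zero LIMSEQ_power_zero) simp
    qed
    moreover have eq: "(\<Sum>i<k. g (r i)) = x - r k - (\<Sum>i<k. f (r i))" for k
      by (induction k) (simp_all add: r0 r)
    ultimately have "(\<lambda>k. \<Sum>i<k. g (r i)) \<longlonglongrightarrow> x - 0 - m'"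
      unfolding eq by (intro tendsto_intros lim_m)
    then have "x - m' \<in> N"
      using closed_sequentially[OF N(2), of "\<lambda>k. \<Sum>i<k. g (r i)"] subspace_sum[OF N(1) fg(2)] by simp blast
    moreover have "m' \<in> M"
      using closed_sequentially[OF M(2) _ lim_m] subspace_sum[OF M(1) fg(1)] by blast
    ultimately have "m - m' \<in> M \<inter> N"
      using mn subspace_diff[OF M(1), of m m'] subspace_diff[OF N(1), of "x - m'" n]
      by (simp add: x_def algebra_simps)
    then have "m = m'"
      using int by simp
    moreover have "norm m' \<le> c * norm x * 2"
      unfolding m'_def
      using summable_norm[OF sf] suminf_le[OF fn sf sums_summable[OF geo]] sums_unique[OF geo] by simp
    ultimately show ?thesis
      by (simp add: x_def mult_ac)
  qed
  with that show ?thesis by blast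
qed

section \<open>Compact perturbations of the identity\<close>

lemma Riesz_lemma:
  fixes M N :: "'a::real_normed_vector set"
  assumes M: "subspace M" "closed M" and N: "subspace N" and "M \<subseteq> N" "\<not> N \<subseteq> M"
  obtains z where "z \<in> N" "norm z = 1" "\<And>w. w \<in> M \<Longrightarrow> 1/2 \<le> norm (z - w)"
proof -
  obtain x where x: "x \<in> N" "x \<notin> M" using assms(5) by blast
  have ne: "M \<noteq> {}" using subspace_0[OF M(1)] by blast
  define d where "d = infdist x M"
  have d: "d > 0"
    using x(2) M(2) ne by (metis d_def in_closed_iff_infdist_zero infdist_nonneg less_eq_real_def)
  have le: "d \<le> norm (x - w)" if "w \<in> M" for w
    unfolding d_def using infdist_le[OF that, of x] by (simp add: dist_norm)
  have "\<exists>m\<in>M. norm (x - m) < 2 * d"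
  proof (rule ccontr)
    assume "\<not> ?thesis"
    then have "2 * d \<le> infdist x M"
      unfolding infdist_notempty[OF ne] by (intro cINF_greatest) (use ne in \<open>auto simp: dist_norm not_less\<close>)
    with d show False by (simp add: d_def)
  qed
  then obtain m where m: "m \<in> M" "norm (x - m) < 2 * d" by blast
  define t where "t = norm (x - m)"
  have t: "t > 0" using le[OF m(1)] d unfolding t_def by linarith
  show ?thesis
  proof (rule that[of "(1/t) *\<^sub>R (x - m)"])
    show "(1/t) *\<^sub>R (x - m) \<in> N"
      using x m \<open>M \<subseteq> N\<close> by (intro subspace_scale subspace_diff N) auto
    show "norm ((1/t) *\<^sub>R (x - m)) = 1"
      using t by (simp add: t_def)
    fix w assume w: "w \<in> M"
    have "(1/t) *\<^sub>R (x - m) - w = (1/t) *\<^sub>R (x - (m + t *\<^sub>R w))"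
      using t by (simp add: algebra_simps)
    then have eq: "t * norm ((1/t) *\<^sub>R (x - m) - w) = norm (x - (m + t *\<^sub>R w))"
      using t by simp
    have "d \<le> norm (x - (m + t *\<^sub>R w))"
      by (intro le subspace_add subspace_scale M m w)
    then have "t * (1/2) \<le> t * norm ((1/t) *\<^sub>R (x - m) - w)"
      unfolding eq using m(2) by (simp add: t_def[symmetric])
    then show "1/2 \<le> norm ((1/t) *\<^sub>R (x - m) - w)"
      using t by (simp only: mult_le_cancel_left_pos)
  qed
qed

text \<open>
  Adjoining a vector \<open>b\<close> at positive distance \<open>d\<close> from a closed subspace keeps it closed: the
  coefficient of \<open>b\<close> in a vector \<open>v\<close> is at most \<open>norm v / d\<close>, so the coefficients along a
  convergent sequence converge.
\<close>

lemma closed_span_finite: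
  fixes B :: "'a::real_normed_vector set"
  assumes "finite B"
  shows "closed (span B)"
  using assms
proof (induction B)
  case (insert b B)
  show ?case
  proof (cases "b \<in> span B")
    case True
    with insert show ?thesis by (simp add: span_redundant)
  next
    case False
    define d where "d = infdist b (span B)"
    have d: "d > 0"
      using False insert.IH
      by (metis d_def empty_iff in_closed_iff_infdist_zero infdist_nonneg less_eq_real_def span_zero)
    have coef: "\<bar>t\<bar> * d \<le> norm (m + t *\<^sub>R b)" if m: "m \<in> span B" for m t
    proof (cases "t = 0")
      case False
      have "d \<le> dist b ((- 1/t) *\<^sub>R m)"
        unfolding d_def by (intro infdist_le span_scale m)
      then have "\<bar>t\<bar> * d \<le> \<bar>t\<bar> * norm (b - (- 1/t) *\<^sub>R m)"
        by (simp add: dist_norm mult_left_mono)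
      also have "\<dots> = norm (t *\<^sub>R (b - (- 1/t) *\<^sub>R m))"
        by simp
      also have "t *\<^sub>R (b - (- 1/t) *\<^sub>R m) = m + t *\<^sub>R b"
        using False by (simp add: algebra_simps)
      finally show ?thesis .
    qed simp
    show ?thesis
      unfolding closed_sequential_limits
    proof (intro allI impI, elim conjE)
      fix x l assume x: "\<forall>n. x n \<in> span (insert b B)" and l: "x \<longlonglongrightarrow> l"
      then have "\<forall>n. \<exists>t. x n - t *\<^sub>R b \<in> span B"
        by (simp add: span_breakdown_eq)
      then obtain t where t: "\<And>n. x n - t n *\<^sub>R b \<in> span B" by metis
      have "Cauchy t"
        unfolding Cauchy_def dist_real_def
      proof (intro allI impI)
        fix e :: real assume "e > 0"
        then obtain k where k: "\<And>m n. m \<ge> k \<Longrightarrow> n \<ge> k \<Longrightarrow> dist (x m) (x n) < e * d"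
          using d LIMSEQ_imp_Cauchy[OF l] unfolding Cauchy_def by (meson mult_pos_pos)
        have "\<bar>t m - t n\<bar> < e" if "m \<ge> k" "n \<ge> k" for m n
        proof -
          have "\<bar>t m - t n\<bar> * d \<le> norm ((x m - t m *\<^sub>R b) - (x n - t n *\<^sub>R b) + (t m - t n) *\<^sub>R b)"
            by (intro coef span_diff t)
          also have "\<dots> = dist (x m) (x n)"
            by (simp add: dist_norm algebra_simps)
          also have "\<dots> < e * d" using k that by blast
          finally show ?thesis using d by simp
        qed
        then show "\<exists>k. \<forall>m\<ge>k. \<forall>n\<ge>k. \<bar>t m - t n\<bar> < e" by blast
      qed
      then obtain t' where "t \<longlonglongrightarrow> t'"
        using Cauchy_convergent convergent_def by blast
      then have "(\<lambda>n. x n - t n *\<^sub>R b) \<longlonglongrightarrow> l - t' *\<^sub>R b"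
        by (intro tendsto_intros l)
      then have "l - t' *\<^sub>R b \<in> span B"
        by (rule closed_sequentially[OF insert.IH t])
      then show "l \<in> span (insert b B)"
        by (auto simp: span_breakdown_eq)
    qed
  qed
qed simp

text \<open>
  Compactness of an operator in terms of sequences. This form passes to sums and compositions by
  choosing subsequences.
\<close>

definition compact_seq :: "('a::real_normed_vector \<Rightarrow>\<^sub>L 'b::real_normed_vector) \<Rightarrow> bool"
  where "compact_seq C \<longleftrightarrow> (\<forall>x :: nat \<Rightarrow> 'a. bounded (range x) \<longrightarrow>
    (\<exists>r l. strict_mono r \<and> (\<lambda>n. C (x (r n))) \<longlonglongrightarrow> l))"

lemma compact_seqE:
  fixes x :: "nat \<Rightarrow> 'a::real_normed_vector"
  assumes "compact_seq C" "\<And>n. norm (x n) \<le> b"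
  obtains r l where "strict_mono r" "(\<lambda>n. C (x (r n))) \<longlonglongrightarrow> l"
proof -
  have "bounded (range x)"
    using assms(2) by (auto simp: bounded_iff)
  then show ?thesis
    using assms(1) that unfolding compact_seq_def by blast
qed

lemma compact_operator_imp_compact_seq:
  assumes "compact_operator C"
  shows "compact_seq C"
  unfolding compact_seq_def
proof (intro allI impI)
  fix x :: "nat \<Rightarrow> 'a" assume "bounded (range x)"
  with assms have "compact (closure (C ` range x))"
    unfolding compact_operator_def by blast
  then have compact: "seq_compact (closure (C ` range x))"
    by (rule compact_imp_seq_compact)
  have "\<forall>n. C (x n) \<in> closure (C ` range x)"
    by (intro allI subsetD[OF closure_subset] imageI rangeI)
  then obtain l r where "strict_mono r" "((\<lambda>n. C (x n)) \<circ> r) \<longlonglongrightarrow> l"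
    by (rule seq_compactE[OF compact])
  then show "\<exists>r l. strict_mono r \<and> (\<lambda>n. C (x (r n))) \<longlonglongrightarrow> l"
    by (intro exI[of _ r] exI[of _ l]) (simp add: comp_def)
qed

lemma compact_seq_compose:
  assumes C: "compact_seq C"
  shows "compact_seq (L o\<^sub>L C)"
  unfolding compact_seq_def
proof (intro allI impI)
  fix x :: "nat \<Rightarrow> 'a" assume "bounded (range x)"
  then have "\<exists>r l. strict_mono r \<and> (\<lambda>n. C (x (r n))) \<longlonglongrightarrow> l"
    by (rule C[unfolded compact_seq_def, rule_format])
  then obtain r l where r: "strict_mono r" "(\<lambda>n. C (x (r n))) \<longlonglongrightarrow> l"
    by (elim exE conjE)
  then have "(\<lambda>n. L (C (x (r n)))) \<longlonglongrightarrow> L l"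
    by (intro blinfun.tendsto tendsto_const)
  with r(1) show "\<exists>r l. strict_mono r \<and> (\<lambda>n. (L o\<^sub>L C) (x (r n))) \<longlonglongrightarrow> l"
    by (intro exI[of _ r] exI[of _ "L l"]) simp
qed

lemma compact_seq_add:
  assumes C: "compact_seq C" and D: "compact_seq D"
  shows "compact_seq (C + D)"
  unfolding compact_seq_def
proof (intro allI impI)
  fix x :: "nat \<Rightarrow> 'a" assume "bounded (range x)"
  then obtain b where b: "\<And>n. norm (x n) \<le> b"
    unfolding bounded_iff by blast
  obtain r l where r: "strict_mono r" "(\<lambda>n. C (x (r n))) \<longlonglongrightarrow> l"
    by (rule compact_seqE[OF C b])
  obtain s k where s: "strict_mono s" "(\<lambda>n. D (x (r (s n)))) \<longlonglongrightarrow> k"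
    by (rule compact_seqE[OF D b])
  have "(\<lambda>n. C (x (r (s n)))) \<longlonglongrightarrow> l"
    using LIMSEQ_subseq_LIMSEQ[OF r(2) s(1)] by (simp add: comp_def)
  then have "(\<lambda>n. (C + D) (x ((r \<circ> s) n))) \<longlonglongrightarrow> l + k"
    using s(2) by (simp add: blinfun.add_left tendsto_add)
  with strict_mono_o[OF r(1) s(1)] show "\<exists>r l. strict_mono r \<and> (\<lambda>n. (C + D) (x (r n))) \<longlonglongrightarrow> l"
    by (intro exI[of _ "r \<circ> s"] exI[of _ "l + k"]) simp
qed

text \<open>
  All applications of compactness to the structure of \<open>1 + C\<close>, except the lower bound for injective
  operators, refute a sequence of unit vectors with uniformly separated images.
\<close>

lemma compact_seq_not_separated:
  fixes x :: "nat \<Rightarrow> 'a::real_normed_vector"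
  assumes C: "compact_seq C" and x: "\<And>n. norm (x n) = 1"
    and sep: "\<And>m n. m < n \<Longrightarrow> 1/2 \<le> norm (C (x m) - C (x n))"
  shows False
proof -
  obtain r l where r: "strict_mono r" "(\<lambda>n. C (x (r n))) \<longlonglongrightarrow> l"
    using x by (metis compact_seqE[OF C] order_refl)
  obtain k where "\<forall>m\<ge>k. \<forall>n\<ge>k. norm (C (x (r m)) - C (x (r n))) < 1/2"
    using CauchyD[OF LIMSEQ_imp_Cauchy[OF r(2)], of "1/2"] by auto
  then have "norm (C (x (r k)) - C (x (r (Suc k)))) < 1/2"
    by simp
  with sep[of "r k" "r (Suc k)"] r(1) show False
    by (simp add: strict_mono_def)
qed

text \<open>
  For a compact perturbation \<open>U = 1 + C\<close> of the identity, \<open>C\<close> equals \<open>U - 1\<close>. Hence \<open>C x - C y\<close> is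
  \<open>- x\<close> modulo any subspace containing \<open>U x\<close>, \<open>U y\<close> and \<open>y\<close>, and Riesz's lemma applied along
  a strict chain of closed subspaces produces unit vectors with separated images.
\<close>

context
  fixes C U :: "'a::banach \<Rightarrow>\<^sub>L 'a"
  assumes C: "compact_seq C" and U: "U = id_blinfun + C"
begin

lemma apply_U: "blinfun_apply U x = x + C x"
  by (simp add: U blinfun.add_left)

text \<open>
  On the kernel, \<open>C\<close> is \<open>- 1\<close>. If the kernel were infinite-dimensional, unit vectors in it could be
  chosen one after the other, each at distance at least \<open>1/2\<close> from the span of the previous ones.
\<close>

lemma kernel_finite_dim: "\<exists>B. finite B \<and> {x. U x = 0} \<subseteq> span B"
proof (rule ccontr)
  define Z where "Z = {x. U x = 0}"
  assume "\<not> ?thesis"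
  then have big: "\<not> Z \<subseteq> span B" if "finite B" for B
    using that by (auto simp: Z_def)
  have Z: "subspace Z"
    by (auto simp: Z_def subspace_def blinfun.add_right blinfun.scaleR_right)
  have "\<exists>z\<in>Z. norm z = 1 \<and> (\<forall>w\<in>span B. 1/2 \<le> norm (z - w))" if "finite B" "B \<subseteq> Z" for B
    by (rule Riesz_lemma[OF subspace_span closed_span_finite[OF that(1)] Z
          span_minimal[OF that(2) Z] big[OF that(1)]]) blast
  then obtain z where z: "\<And>B. finite B \<Longrightarrow> B \<subseteq> Z \<Longrightarrow> z B \<in> Z"
    "\<And>B. finite B \<Longrightarrow> B \<subseteq> Z \<Longrightarrow> norm (z B) = 1"
    "\<And>B w. finite B \<Longrightarrow> B \<subseteq> Z \<Longrightarrow> w \<in> span B \<Longrightarrow> 1/2 \<le> norm (z B - w)"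
    by metis
  define S where "S n = ((\<lambda>B. insert (z B) B) ^^ n) {}" for n
  have S: "S 0 = {}" "S (Suc n) = insert (z (S n)) (S n)" for n
    by (simp_all add: S_def)
  have fin: "finite (S n) \<and> S n \<subseteq> Z" for n
    by (induction n) (auto simp: S z(1))
  have mem: "z (S m) \<in> S n" if "m < n" for m n
    using that by (induction n) (auto simp: S less_Suc_eq)
  show False
  proof (rule compact_seq_not_separated[OF C])
    show "norm (z (S n)) = 1" for n
      using fin[of n] z(2) by blast
    fix m n :: nat assume "m < n"
    have CZ: "C (z (S k)) = - z (S k)" for k
      using z(1)[of "S k"] fin[of k] by (simp add: Z_def apply_U add_eq_0_iff)
    have "1/2 \<le> norm (z (S n) - z (S m))"
      using z(3)[of "S n" "z (S m)"] fin[of n] span_base[OF mem[OF \<open>m < n\<close>]] by blast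
    then show "1/2 \<le> norm (C (z (S m)) - C (z (S n)))"
      by (simp add: CZ)
  qed
qed

text \<open>
  Otherwise there are unit vectors \<open>y n\<close> with \<open>U (y n)\<close> tending to \<open>0\<close>. Along a subsequence \<open>C (y n)\<close>
  converges, hence so does \<open>y n = U (y n) - C (y n)\<close>, and its limit is a unit vector in the kernel.
\<close>

lemma injective_bounded_below:
  assumes inj: "\<And>x. U x = 0 \<Longrightarrow> x = 0"
  obtains a where "a > 0" "\<forall>x. a * norm x \<le> norm (U x)"
proof -
  have "\<exists>a>0. \<forall>x. a * norm x \<le> norm (U x)"
  proof (rule ccontr)
    assume "\<not> ?thesis"
    then have "\<exists>x. norm (U x) < 1 / real (Suc n) * norm x" for n
      by (metis not_less of_nat_0_less_iff zero_less_Suc zero_less_divide_1_iff)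
    then obtain x where x: "\<And>n. norm (U (x n)) < 1 / real (Suc n) * norm (x n)" by metis
    have x0: "norm (x n) > 0" for n
      using x[of n] by (cases "x n = 0") auto
    define y where "y n = (1 / norm (x n)) *\<^sub>R x n" for n
    have y1: "norm (y n) = 1" for n
      using x0[of n] by (simp add: y_def)
    have "norm (U (y n)) \<le> 1 / real (Suc n)" for n
      using x[of n] x0[of n] by (simp add: y_def blinfun.scaleR_right field_simps)
    then have Uy: "(\<lambda>n. U (y n)) \<longlonglongrightarrow> 0"
      by (intro Lim_null_comparison[OF _ LIMSEQ_Suc[OF lim_1_over_n]]) auto
    obtain r l where r: "strict_mono r" "(\<lambda>n. C (y (r n))) \<longlonglongrightarrow> l"
      using compact_seqE[OF C, of y 1] y1 by auto
    have Ur: "(\<lambda>n. U (y (r n))) \<longlonglongrightarrow> 0"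
      using LIMSEQ_subseq_LIMSEQ[OF Uy r(1)] by (simp add: comp_def)
    then have yl: "(\<lambda>n. y (r n)) \<longlonglongrightarrow> 0 - l"
      using tendsto_diff[OF Ur r(2)] by (simp add: apply_U)
    then have "(\<lambda>n. U (y (r n))) \<longlonglongrightarrow> U (0 - l)"
      by (intro blinfun.tendsto tendsto_const)
    then have "0 - l = 0"
      using Ur LIMSEQ_unique inj by blast
    moreover have "norm (0 - l) = 1"
      using tendsto_norm[OF yl] y1 by (simp add: LIMSEQ_const_iff)
    ultimately show False by simp
  qed
  with that show ?thesis by blast
qed

lemma bounded_linear_iterate: "bounded_linear (blinfun_apply U ^^ n)"
proof (induction n)
  case 0
  then show ?case by (simp add: id_def bounded_linear_ident)
next
  case (Suc n)
  then show ?case by (simp add: comp_def bounded_linear_compose[OF blinfun.bounded_linear_right])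
qed

text \<open>
  The ranges of the powers of \<open>U\<close> are closed, because the powers are bounded below. If \<open>U\<close> is not
  surjective, then injectivity makes them strictly decreasing.
\<close>

lemma injective_imp_surjective:
  assumes inj: "\<And>x. U x = 0 \<Longrightarrow> x = 0"
  shows "surj (blinfun_apply U)"
proof (rule ccontr)
  assume "\<not> surj (blinfun_apply U)"
  then obtain y where y: "y \<notin> range U" by blast
  obtain a where a: "a > 0" "\<forall>x. a * norm x \<le> norm (U x)"
    by (rule injective_bounded_below[OF inj])
  have below: "a ^ n * norm x \<le> norm ((blinfun_apply U ^^ n) x)" for n x
  proof (induction n)
    case (Suc n)
    then have "a * (a ^ n * norm x) \<le> a * norm ((blinfun_apply U ^^ n) x)"
      using a(1) by (intro mult_left_mono) auto
    also have "\<dots> \<le> norm (U ((blinfun_apply U ^^ n) x))" using a(2) by (rule spec)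
    finally show ?case by (simp add: mult.assoc)
  qed simp
  define R where "R n = range (blinfun_apply U ^^ n)" for n
  have R: "subspace (R n)" for n
    unfolding R_def using bounded_linear_iterate
    by (intro linear_subspace_image subspace_UNIV) (simp add: bounded_linear.linear)
  have closed: "closed (R n)" for n
  proof -
    have "complete (R n)"
      unfolding R_def
      by (rule complete_isometric_image[of "a ^ n"])
        (use a(1) below bounded_linear_iterate in \<open>auto simp: complete_UNIV\<close>)
    then show ?thesis by (rule complete_imp_closed)
  qed
  have dec1: "R (Suc n) \<subseteq> R n" for n
    by (auto simp: R_def funpow_swap1 simp del: funpow.simps simp: funpow_Suc_right)
  have dec: "R n \<subseteq> R m" if "m \<le> n" for m n
    using lift_Suc_antimono_le[of R] dec1 that by blast
  have RU: "U x \<in> R (Suc n)" if "x \<in> R n" for x n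
    using that by (auto simp: R_def)
  have inj_n: "x = x'" if "(blinfun_apply U ^^ n) x = (blinfun_apply U ^^ n) x'" for x x' n
    using below[of n "x - x'"] that zero_less_power[OF a(1), of n]
      linear_diff[OF bounded_linear.linear[OF bounded_linear_iterate[of n]], of x x']
    by (auto simp: mult_le_0_iff)
  have strict: "\<not> R n \<subseteq> R (Suc n)" for n
  proof
    assume "R n \<subseteq> R (Suc n)"
    then have "(blinfun_apply U ^^ n) y \<in> R (Suc n)" by (auto simp: R_def)
    then obtain x where "(blinfun_apply U ^^ n) y = (blinfun_apply U ^^ n) (U x)"
      by (auto simp: R_def funpow_swap1 simp del: funpow.simps simp: funpow_Suc_right)
    then show False using inj_n y by blast
  qed
  have "\<exists>z\<in>R n. norm z = 1 \<and> (\<forall>w\<in>R (Suc n). 1/2 \<le> norm (z - w))" for n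
    by (rule Riesz_lemma[OF R closed R dec1 strict]) blast
  then obtain x where x: "\<And>n. x n \<in> R n" "\<And>n. norm (x n) = 1"
    "\<And>n w. w \<in> R (Suc n) \<Longrightarrow> 1/2 \<le> norm (x n - w)"
    by metis
  show False
  proof (rule compact_seq_not_separated[OF C x(2)])
    fix m n :: nat assume "m < n"
    then have "x n \<in> R (Suc m)" "U (x n) \<in> R (Suc m)"
      using x(1)[of n] RU[OF x(1)[of n]] dec[of "Suc m" n] dec[of "Suc m" "Suc n"] by auto
    then have "U (x m) - U (x n) + x n \<in> R (Suc m)"
      using RU[OF x(1)] by (intro subspace_add subspace_diff R)
    then have "1/2 \<le> norm (x m - (U (x m) - U (x n) + x n))"
      by (rule x(3))
    also have "x m - (U (x m) - U (x n) + x n) = - (C (x m) - C (x n))"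
      by (simp add: apply_U)
    finally show "1/2 \<le> norm (C (x m) - C (x n))" by (simp only: norm_minus_cancel)
  qed
qed

text \<open>
  If \<open>U\<close> is surjective, the preimages of a nonzero kernel vector under the powers of \<open>U\<close> show that the
  kernels of these powers are strictly increasing.
\<close>

lemma surjective_imp_injective:
  assumes surj: "surj (blinfun_apply U)" and "U x = 0"
  shows "x = 0"
proof (rule ccontr)
  assume "x \<noteq> 0"
  define Z where "Z n = {x. (blinfun_apply U ^^ n) x = 0}" for n
  have lin: "linear (blinfun_apply U ^^ n)" for n
    using bounded_linear_iterate by (rule bounded_linear.linear)
  have Z: "subspace (Z n)" for n
    unfolding Z_def using linear_subspace_kernel[OF lin] by simp
  have closed: "closed (Z n)" for n
    unfolding Z_def
    by (intro closed_Collect_eq bounded_linear.continuous_on[OF bounded_linear_iterate] continuous_intros)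
  have inc1: "Z n \<subseteq> Z (Suc n)" for n
    by (auto simp: Z_def)
  have inc: "Z m \<subseteq> Z n" if "m \<le> n" for m n
    using lift_Suc_mono_le[of Z] inc1 that by blast
  have ZU: "U z \<in> Z n" if "z \<in> Z (Suc n)" for z n
    using that by (auto simp: Z_def funpow_Suc_right simp del: funpow.simps)
  have "\<exists>z. (blinfun_apply U ^^ n) z = x" for n
  proof (induction n)
    case (Suc n)
    then obtain z where "(blinfun_apply U ^^ n) z = x" by blast
    moreover obtain z' where "z = U z'" using surj by blast
    ultimately have "(blinfun_apply U ^^ Suc n) z' = x"
      by (simp add: funpow_Suc_right del: funpow.simps)
    then show ?case by blast
  qed simp
  then have strict: "\<not> Z (Suc n) \<subseteq> Z n" for n
    using \<open>x \<noteq> 0\<close> \<open>U x = 0\<close> by (fastforce simp: Z_def subset_iff)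
  have "\<exists>z\<in>Z (Suc n). norm z = 1 \<and> (\<forall>w\<in>Z n. 1/2 \<le> norm (z - w))" for n
    by (rule Riesz_lemma[OF Z closed Z inc1 strict]) blast
  then obtain z where z: "\<And>n. z n \<in> Z (Suc n)" "\<And>n. norm (z n) = 1"
    "\<And>n w. w \<in> Z n \<Longrightarrow> 1/2 \<le> norm (z n - w)"
    by metis
  show False
  proof (rule compact_seq_not_separated[OF C z(2)])
    fix m n :: nat assume "m < n"
    then have "z m \<in> Z n" "U (z m) \<in> Z n"
      using z(1)[of m] ZU[OF z(1)[of m]] inc[of "Suc m" n] inc[of m n] by auto
    then have "U (z n) - U (z m) + z m \<in> Z n"
      using ZU[OF z(1)] by (intro subspace_add subspace_diff Z)
    then have "1/2 \<le> norm (z n - (U (z n) - U (z m) + z m))"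
      by (rule z(3))
    also have "z n - (U (z n) - U (z m) + z m) = C (z m) - C (z n)"
      by (simp add: apply_U)
    finally show "1/2 \<le> norm (C (z m) - C (z n))" .
  qed
qed

end

section \<open>Projections and inner inverses\<close>

text \<open>
  The range and the kernel of a continuous projection are complementary closed subspaces. The
  projection is taken relative to a carrier \<open>Y\<close> so that the result also covers the dual space.
\<close>

lemma complemented_projection:
  assumes s: "normed_space s" and Y: "closed_subspace s Y Y"
    and E: "Vector_Spaces.linear s s E" "continuous_on UNIV E" "E ` Y \<subseteq> Y"
    and idem: "\<And>y. y \<in> Y \<Longrightarrow> E (E y) = E y"
  shows "complemented s Y (E ` Y)" and "complemented s Y (kernel_on Y E)"
proof -
  interpret S: normed_space s by (rule s)
  have subY: "S.subspace Y"
    using Y by (simp add: closed_subspace_def)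
  have add: "E (x + y) = E x + E y" and scale: "E (s c x) = s c (E x)" for c x y
    using E(1) by (auto simp: S.linear_iff[OF s])
  have zero: "E 0 = 0"
    using add[of 0 0] by simp
  have diff: "E (x - y) = E x - E y" for x y
    using add[of "x - y" y] by simp
  have range: "E ` Y = {y \<in> Y. E y = y}"
    using E(3) idem by force
  have "closedin (top_of_set Y) {y \<in> Y. E y = y}"
    using closedin_closed_Int[OF closed_Collect_eq[OF E(2) continuous_on_id], of Y]
    by (simp add: Int_def)
  then have 1: "closed_subspace s Y (E ` Y)"
    unfolding closed_subspace_def range
    using subY by (auto simp: S.subspace_def add scale zero)
  have "closedin (top_of_set Y) {y \<in> Y. E y = 0}"
    using closedin_closed_Int[OF closed_Collect_eq[OF E(2) continuous_on_const], of Y 0]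
    by (simp add: Int_def)
  then have 2: "closed_subspace s Y (kernel_on Y E)"
    unfolding closed_subspace_def kernel_on_def
    using subY by (auto simp: S.subspace_def add scale zero)
  have "y \<in> {m + n |m n. m \<in> E ` Y \<and> n \<in> kernel_on Y E}" if y: "y \<in> Y" for y
  proof -
    have "y = E y + (y - E y)" by simp
    moreover have "y - E y \<in> kernel_on Y E"
      using y E(3) S.subspace_diff[OF subY] by (auto simp: kernel_on_def diff idem)
    ultimately show ?thesis using y by blast
  qed
  moreover have "{m + n |m n. m \<in> E ` Y \<and> n \<in> kernel_on Y E} \<subseteq> Y"
    using E(3) S.subspace_add[OF subY] by (auto simp: kernel_on_def)
  ultimately have sum: "{m + n |m n. m \<in> E ` Y \<and> n \<in> kernel_on Y E} = Y"
    by blast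
  have int: "E ` Y \<inter> kernel_on Y E = {0}"
    using S.subspace_0[OF subY] by (auto simp: range kernel_on_def zero)
  show "complemented s Y (E ` Y)"
    unfolding complemented_def using 1 2 sum int by blast
  have sum': "{m + n |m n. m \<in> kernel_on Y E \<and> n \<in> E ` Y} = Y"
    by (subst sum[symmetric]) (metis (no_types, opaque_lifting) add.commute)
  have int': "kernel_on Y E \<inter> E ` Y = {0}"
    using int by (simp add: Int_commute)
  show "complemented s Y (kernel_on Y E)"
    unfolding complemented_def using 1 2 sum' int' by blast
qed

context normed_space
begin

text \<open>
  Additivity is part of the type of bounded real-linear maps; only homogeneity over the scalar field
  remains.
\<close>

lemma bounded_ops_iff: "A \<in> bounded_ops smul \<longleftrightarrow> (\<forall>c x. A (smul c x) = smul c (A x))"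
  by (simp add: bounded_ops_def linear_iff[OF normed_space_axioms] blinfun.add_right)

lemma dual_iff: "f \<in> dual smul \<longleftrightarrow> (\<forall>c x. f (smul c x) = c * f x)"
  by (simp add: dual_def linear_iff[OF normed_space_mult] blinfun.add_right)

lemma bounded_ops_intros:
  assumes "A \<in> bounded_ops smul" "B \<in> bounded_ops smul"
  shows "A + B \<in> bounded_ops smul" "A - B \<in> bounded_ops smul" "A o\<^sub>L B \<in> bounded_ops smul"
  using assms
  by (auto simp: bounded_ops_iff blinfun.add_left blinfun.diff_left scale_right_distrib scale_right_diff_distrib)

lemma bounded_ops_id: "id_blinfun \<in> bounded_ops smul"
  and bounded_ops_zero: "0 \<in> bounded_ops smul"
  by (auto simp: bounded_ops_iff)

lemma real_subspace: "subspace M \<Longrightarrow> Real_Vector_Spaces.subspace M"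
  by (auto simp: real_vector.subspace_def subspace_def simp flip: scale_of_real)

lemma real_span_subset: "Real_Vector_Spaces.span B \<subseteq> span B"
  by (intro real_vector.span_minimal real_subspace subspace_span span_superset)

text \<open>
  A basis of \<open>S\<close> together with \<open>y\<close> is an independent subset of \<open>T\<close>.
\<close>

lemma dim_less:
  assumes S: "subspace S" "S \<subseteq> T" and T: "T \<subseteq> span B" "finite B" and y: "y \<in> T" "y \<notin> S"
  shows "dim S < dim T"
proof -
  obtain BT where BT: "BT \<subseteq> T" "independent BT" "T \<subseteq> span BT" "card BT = dim T"
    using basis_exists by blast
  obtain BS where BS: "BS \<subseteq> S" "independent BS" "S \<subseteq> span BS" "card BS = dim S"
    using basis_exists by blast
  have fin: "finite BT"
    using independent_span_bound[OF T(2) BT(2) order_trans[OF BT(1) T(1)]] by (rule conjunct1)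
  have "y \<notin> span BS"
    using span_minimal[OF BS(1) S(1)] y(2) by (rule contra_subsetD)
  then have indep: "independent (insert y BS)"
    using BS(2) by (rule independent_insertI)
  have notin: "y \<notin> BS"
    using BS(1) y(2) by (rule contra_subsetD)
  have "insert y BS \<subseteq> span BT"
    using order_trans[OF order_trans[OF BS(1) S(2)] BT(3)] subsetD[OF BT(3) y(1)]
    by (rule insert_subsetI[rotated])
  then have "finite (insert y BS) \<and> card (insert y BS) \<le> card BT"
    by (rule independent_span_bound[OF fin indep])
  then show ?thesis
    using notin by (auto simp: BS(4) BT(4))
qed

definition inner_invertible :: "('a \<Rightarrow>\<^sub>L 'a) \<Rightarrow> bool"
  where "inner_invertible A \<longleftrightarrow> (\<exists>D\<in>bounded_ops smul. A o\<^sub>L D o\<^sub>L A = A)"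

text \<open>
  Von Neumann's lemma on regular ring elements. The remainder is
  \<open>W = A (1 - D A) = (1 - A D) A\<close>. If \<open>W Z W = W\<close>, then
  \<open>A = A D A + W = A (D + (1 - D A) Z (1 - A D)) A\<close>.
\<close>

lemma inner_invertible_remainder:
  assumes A: "A \<in> bounded_ops smul" and D: "D \<in> bounded_ops smul"
    and rem: "inner_invertible (A - (A o\<^sub>L D o\<^sub>L A))"
  shows "inner_invertible A"
proof -
  define W where "W = A - (A o\<^sub>L D o\<^sub>L A)"
  obtain Z where Z: "Z \<in> bounded_ops smul" "W o\<^sub>L Z o\<^sub>L W = W"
    using rem by (auto simp: inner_invertible_def W_def)
  define D' where "D' = D + ((id_blinfun - (D o\<^sub>L A)) o\<^sub>L Z o\<^sub>L (id_blinfun - (A o\<^sub>L D)))"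
  have "A (D' (A x)) = A x" for x
  proof -
    have W: "W v = A v - A (D (A v))" for v
      by (simp add: W_def blinfun.diff_left)
    have "W (Z (W x)) = W x"
      using Z(2) by (metis blinfun_apply_blinfun_compose)
    moreover have "A (D' (A x)) = A (D (A x)) + W (Z (W x))"
      by (simp add: D'_def W blinfun.add_left blinfun.diff_left blinfun.add_right blinfun.diff_right)
    ultimately show ?thesis by (simp add: W)
  qed
  then have "A o\<^sub>L D' o\<^sub>L A = A"
    by (intro blinfun_eqI) simp
  moreover have "D' \<in> bounded_ops smul"
    unfolding D'_def by (intro bounded_ops_intros bounded_ops_id A D Z)
  ultimately show ?thesis
    by (auto simp: inner_invertible_def)
qed

definition rank_one :: "('a \<Rightarrow>\<^sub>L 'k) \<Rightarrow> 'a \<Rightarrow> 'a \<Rightarrow>\<^sub>L 'a"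
  where "rank_one f y = Blinfun (\<lambda>x. smul (f x) y)"

lemma rank_one_apply [simp]: "rank_one f y x = smul (f x) y"
proof -
  have "bounded_linear (\<lambda>x. smul (f x) y)"
  proof (rule bounded_linear_intro)
    show "smul (f (x + x')) y = smul (f x) y + smul (f x') y" for x x'
      by (simp add: blinfun.add_right scale_left_distrib)
    show "smul (f (r *\<^sub>R x)) y = r *\<^sub>R smul (f x) y" for r x
      by (simp add: blinfun.scaleR_right scaleR_conv_of_real scale_of_real flip: scale_scale)
    show "norm (smul (f x) y) \<le> norm x * (norm f * norm y)" for x
      using mult_right_mono[OF norm_blinfun[of f x], of "norm y"] by (simp add: norm_scale mult_ac)
  qed
  then show ?thesis
    by (simp add: rank_one_def bounded_linear_Blinfun_apply)
qed

lemma rank_one_bounded_ops: "f \<in> dual smul \<Longrightarrow> rank_one f y \<in> bounded_ops smul"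
  by (simp add: bounded_ops_iff dual_iff)

definition separating_dual :: bool
  where "separating_dual \<longleftrightarrow> (\<forall>x. x \<noteq> 0 \<longrightarrow> (\<exists>f\<in>dual smul. f x = 1))"

text \<open>
  Choose \<open>A x0 \<noteq> 0\<close> and a functional \<open>f\<close> with value \<open>1\<close> there. With \<open>D x = f x \<cdot> x0\<close> the remainder
  \<open>A - A D A\<close> has its range in the intersection of the range of \<open>A\<close> with the kernel of \<open>f\<close>, which
  misses \<open>A x0\<close>. So the rank drops, and von Neumann's lemma gives the induction step.
\<close>

lemma finite_rank_inner_invertible:
  assumes sep: "separating_dual" and "A \<in> bounded_ops smul" "finite B" "range A \<subseteq> span B"
  shows "inner_invertible A"
  using assms(2,4)
proof (induction "dim (range A)" arbitrary: A rule: less_induct)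
  case less
  show ?case
  proof (cases "A = 0")
    case True
    then show ?thesis
      using bounded_ops_zero by (auto simp: inner_invertible_def intro!: blinfun_eqI)
  next
    case False
    then obtain x0 where "A x0 \<noteq> 0"
      by (metis blinfun_eqI zero_blinfun.rep_eq)
    then obtain f where f: "f \<in> dual smul" "f (A x0) = 1"
      using sep by (auto simp: separating_dual_def)
    define D where "D = rank_one f x0"
    have D: "D \<in> bounded_ops smul"
      unfolding D_def using f(1) by (rule rank_one_bounded_ops)
    define W where "W = A - (A o\<^sub>L D o\<^sub>L A)"
    have W: "W \<in> bounded_ops smul"
      unfolding W_def by (intro bounded_ops_intros less.prems D)
    have Wx: "W x = A x - smul (f (A x)) (A x0)" for x
      using less.prems(1) by (simp add: W_def D_def blinfun.diff_left bounded_ops_iff)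
    have sub: "range W \<subseteq> range A"
    proof clarify
      fix x
      have "W x = A (x - smul (f (A x)) x0)"
        using less.prems(1) by (simp add: Wx blinfun.diff_right bounded_ops_iff)
      then show "W x \<in> range A" by simp
    qed
    have "f (W x) = 0" for x
      using f by (simp add: Wx blinfun.diff_right dual_iff)
    then have "A x0 \<notin> range W"
      using f(2) by (metis imageE zero_neq_one)
    moreover have "subspace (range W)"
      using W module_hom.subspace_image[of smul smul W UNIV]
      by (simp add: bounded_ops_def Vector_Spaces.linear_def)
    ultimately have "dim (range W) < dim (range A)"
      using sub less.prems(2) assms(3) by (intro dim_less[of _ _ B "A x0"]) auto
    then have "inner_invertible W"
      using sub less.prems(2) W by (intro less.hyps) auto
    then show ?thesis
      unfolding W_def by (rule inner_invertible_remainder[OF less.prems(1) D])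
  qed
qed

end

section \<open>Functionals over finite-dimensional scalar fields\<close>

text \<open>
  The map \<open>c \<mapsto> c x0\<close> embeds the scalar field into the span of \<open>B\<close>.
\<close>

lemma (in normed_space) scalars_finite_dim:
  assumes "x0 \<noteq> 0" "finite B" "range (\<lambda>c. smul c x0) \<subseteq> Real_Vector_Spaces.span B"
  obtains Bk :: "'k set" where "finite Bk" "\<not> Real_Vector_Spaces.dependent Bk"
    "Real_Vector_Spaces.span Bk = UNIV"
proof -
  obtain Bk :: "'k set" where Bk: "\<not> Real_Vector_Spaces.dependent Bk" "UNIV \<subseteq> Real_Vector_Spaces.span Bk"
    by (rule real_vector.maximal_independent_subset[of UNIV])
  have inj: "inj_on (\<lambda>c. smul c x0) S" for S
    using assms(1) by (intro inj_onI) (simp only: scale_cancel_right simp_thms)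
  have "Real_Vector_Spaces.linear (\<lambda>c. smul c x0)"
    by (intro Real_Vector_Spaces.linearI)
      (simp_all only: scale_left_distrib scaleR_conv_of_real scale_scale[symmetric] scale_of_real)
  then have "\<not> Real_Vector_Spaces.dependent ((\<lambda>c. smul c x0) ` Bk)"
    by (rule real_vector.linear_independent_injective_image[OF _ Bk(1) inj])
  then have "finite ((\<lambda>c. smul c x0) ` Bk) \<and> card ((\<lambda>c. smul c x0) ` Bk) \<le> card B"
    by (rule real_vector.independent_span_bound[OF assms(2)])
      (rule order_trans[OF image_mono[OF subset_UNIV] assms(3)])
  then have "finite Bk"
    by (intro finite_imageD[OF _ inj]) (rule conjunct1)
  then show ?thesis
    using Bk(1) antisym[OF subset_UNIV Bk(2)] by (rule that)
qed

text \<open>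
  On a finite-dimensional field extension of the reals, \<open>(d, c) \<mapsto> r (d * c)\<close> is a nondegenerate bilinear
  form, so every real functional \<open>g\<close> is of the form \<open>c \<mapsto> r (d * c)\<close>. The representing element
  \<open>d\<close> is written as an explicit combination of the values of \<open>g\<close> on the basis, because in this form
  it depends continuously on \<open>g\<close> when \<open>g\<close> itself depends on a parameter.
\<close>

lemma scalar_functional_represented:
  fixes Bk :: "'k::real_normed_field set"
  assumes fin: "finite Bk" and indep: "independent Bk" and span: "span Bk = UNIV"
    and r: "linear r" "r (1::'k) \<noteq> (0::real)"
  obtains h :: "'k \<Rightarrow> 'k" where "\<And>(g :: 'k \<Rightarrow> real) c. linear g \<Longrightarrow> r ((\<Sum>b\<in>Bk. g b *\<^sub>R h b) * c) = g c"
proof -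
  interpret fd: finite_dimensional_vector_space "scaleR :: real \<Rightarrow> 'k \<Rightarrow> 'k" Bk
    using fin indep span
    by unfold_locales (simp_all add: dependent_raw_def span_raw_def)
  define \<Phi> where "\<Phi> d = (\<Sum>b\<in>Bk. r (d * b) *\<^sub>R b)" for d
  have radd: "r (x + y) = r x + r y" and rscale: "r (t *\<^sub>R x) = t * r x" for x y t
    using r(1) by (simp_all add: linear_add linear_scale)
  have lin: "linear \<Phi>"
    by (intro linearI)
      (simp_all add: \<Phi>_def radd rscale algebra_simps sum.distrib scaleR_sum_right)
  have ext: "g = g'" if "linear g" "linear g'" "\<And>b. b \<in> Bk \<Longrightarrow> g b = g' b" for g g' :: "'k \<Rightarrow> real"
    using linear_eq_on_span[OF that(1,2), of Bk] that(3) span by auto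
  have lmul: "linear (\<lambda>c. r (d * c))" for d
    by (intro linearI) (simp_all add: radd rscale distrib_left)
  \<comment> \<open>Nondegeneracy: for \<open>d \<noteq> 0\<close> the form takes the value \<open>r 1\<close> at \<open>(d, inverse d)\<close>.\<close>
  have "d = 0" if "\<Phi> d = 0" for d
  proof (rule ccontr)
    assume "d \<noteq> 0"
    have "r (d * b) = 0" if "b \<in> Bk" for b
      using independentD[OF indep fin order_refl, of "\<lambda>b. r (d * b)"] \<open>\<Phi> d = 0\<close> that
      by (simp add: \<Phi>_def)
    then have "(\<lambda>c. r (d * c)) = (\<lambda>c. 0)"
      by (intro ext lmul) (auto simp: linear_iff)
    then have "r (d * inverse d) = 0" by metis
    with \<open>d \<noteq> 0\<close> r(2) show False by simp
  qed
  then have "inj \<Phi>"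
    using linear_injective_0[OF lin] by blast
  then have "surj \<Phi>"
    using lin by (intro fd.linear_inj_imp_surj) (simp_all add: linear_def)
  then obtain h where h: "\<And>c. \<Phi> (h c) = c"
    by (metis surj_f_inv_f)
  show ?thesis
  proof (rule that)
    fix g :: "'k \<Rightarrow> real" and c assume g: "linear g"
    define d where "d = (\<Sum>b\<in>Bk. g b *\<^sub>R h b)"
    have "\<Phi> d = (\<Sum>b\<in>Bk. g b *\<^sub>R b)"
      unfolding d_def by (simp add: linear_sum[OF lin] linear_scale[OF lin] h)
    then have eq: "(\<Sum>b\<in>Bk. (r (d * b) - g b) *\<^sub>R b) = 0"
      by (simp add: \<Phi>_def algebra_simps sum_subtractf)
    have "r (d * b) = g b" if "b \<in> Bk" for b
      using independentD[OF indep fin order_refl eq that] by simp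
    then have "(\<lambda>c. r (d * c)) = g"
      by (intro ext lmul g)
    then show "r ((\<Sum>b\<in>Bk. g b *\<^sub>R h b) * c) = g c"
      unfolding d_def[symmetric] by metis
  qed
qed

text \<open>
  This generalizes the passage from a real functional \<open>u\<close> to the complex functional
  \<open>z \<mapsto> u z - i u (i z)\<close>. Given a real functional \<open>u\<close>, let \<open>F z\<close> be the scalar that represents the real
  functional \<open>c \<mapsto> u (c z)\<close>. Since representing scalars are unique, \<open>F\<close> is linear over the scalar field,
  and \<open>r0 (F z) = u z\<close> shows that \<open>F\<close> is nonzero where \<open>u\<close> is.
\<close>

lemma (in normed_space) separating_dual_finite_dim_scalars:
  fixes Bk :: "'k set"
  assumes fin: "finite Bk" and indep: "\<not> Real_Vector_Spaces.dependent Bk"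
    and span: "Real_Vector_Spaces.span Bk = UNIV"
  shows separating_dual
  unfolding separating_dual_def
proof (intro allI impI)
  fix x :: 'a assume "x \<noteq> 0"
  obtain u :: "'a \<Rightarrow>\<^sub>L real" where u: "u x \<noteq> 0"
    using real_functional_nonzero[OF \<open>x \<noteq> 0\<close>] by blast
  obtain r0 :: "'k \<Rightarrow>\<^sub>L real" where "r0 1 \<noteq> 0"
    using real_functional_nonzero[of "1::'k"] by auto
  then have r: "linear (blinfun_apply r0)" "r0 1 \<noteq> 0"
    by (auto intro: bounded_linear.linear blinfun.bounded_linear_right)
  obtain h where h: "\<And>(g :: 'k \<Rightarrow> real) c. Real_Vector_Spaces.linear g \<Longrightarrow> r0 ((\<Sum>b\<in>Bk. g b *\<^sub>R h b) * c) = g c"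
    using scalar_functional_represented[OF fin indep span r] by blast
  have ext: "d = d'" if "\<And>c. r0 (d * c) = r0 (d' * c)" for d d'
  proof (rule ccontr)
    assume "d \<noteq> d'"
    then have "r0 ((d - d') * inverse (d - d')) \<noteq> 0" using r(2) by simp
    moreover have "r0 ((d - d') * c) = 0" for c
      using that by (simp add: left_diff_distrib blinfun.diff_right)
    ultimately show False by blast
  qed
  have smul_bl: "bounded_linear (smul c)" for c
  proof (rule bounded_linear_intro[where K = "norm c"])
    show "smul c (r *\<^sub>R y) = r *\<^sub>R smul c y" for r y
      by (simp only: scale_of_real[symmetric] scale_scale mult.commute)
  qed (simp_all add: scale_right_distrib norm_scale mult.commute)
  define F where "F z = (\<Sum>b\<in>Bk. u (smul b z) *\<^sub>R h b)" for z
  have bl: "bounded_linear F"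
    unfolding F_def
    by (intro bounded_linear_sum bounded_linear_scaleR_const
        bounded_linear_compose[OF blinfun.bounded_linear_right] smul_bl)
  have rF: "r0 (F z * c) = u (smul c z)" for z c
    unfolding F_def
  proof (rule h, rule Real_Vector_Spaces.linearI)
    show "u (smul (r *\<^sub>R b) z) = r *\<^sub>R u (smul b z)" for r b
      by (simp only: scaleR_conv_of_real[of r b] scale_scale[symmetric] scale_of_real blinfun.scaleR_right)
  qed (simp add: scale_left_distrib blinfun.add_right)
  have "F (smul c z) = c * F z" for c z
  proof (rule ext)
    fix d
    have "c * F z * d = F z * (d * c)" by (simp only: mult_ac)
    then show "r0 (F (smul c z) * d) = r0 (c * F z * d)"
      by (simp only: rF scale_scale)
  qed
  moreover have "F x \<noteq> 0"
    using rF[of x 1] u by auto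
  ultimately show "\<exists>f\<in>dual smul. f x = 1"
    using bl
    by (intro bexI[of _ "dual_scale (inverse (F x)) (Blinfun F)"])
      (simp_all add: dual_iff bounded_linear_Blinfun_apply mult.left_commute)
qed

section \<open>Left invertibility modulo compact operators\<close>

text \<open>
  \<open>L x\<close> is the unique \<open>a\<close> for which \<open>x - T a\<close> lies in the complement of the range of \<open>T\<close>. It is bounded
  because \<open>T a\<close> is the projection of \<open>x\<close> onto the range and \<open>T\<close> is bounded below.
\<close>

lemma bounded_below_left_inverse:
  fixes smul :: "'k::real_normed_field \<Rightarrow> 'a::banach \<Rightarrow> 'a"
  assumes "normed_space smul" and T: "T \<in> bounded_ops smul" "bounded_below T"
    and compl: "complemented smul UNIV (closure (range (blinfun_apply T)))"
  obtains L where "L \<in> bounded_ops smul" "L o\<^sub>L T = id_blinfun"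
proof -
  interpret normed_space smul by fact
  obtain \<alpha> where \<alpha>: "\<alpha> > 0" "\<And>x. \<alpha> * norm x \<le> norm (T x)"
    using T(2) unfolding bounded_below_def by auto
  have "complete (range T)"
    using \<alpha> by (intro complete_isometric_image[of \<alpha>]) (auto simp: complete_UNIV blinfun.bounded_linear_right)
  then have closed: "closed (range T)"
    by (rule complete_imp_closed)
  obtain N where N: "closed_subspace smul UNIV N" "{m + n |m n. m \<in> range T \<and> n \<in> N} = UNIV"
      "range T \<inter> N = {0}"
    using compl unfolding complemented_def closure_closed[OF closed] by (elim conjE exE)
  have subN: "subspace N" and closedN: "closed N" and subT: "subspace (range T)"
    using N(1) compl closed by (auto simp: closed_subspace_def complemented_def)
  have sum: "\<exists>m\<in>range T. \<exists>n\<in>N. x = m + n" for x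
    using N(2) by blast
  obtain c where c: "\<forall>m\<in>range T. \<forall>n\<in>N. norm m \<le> c * norm (m + n)"
    by (rule closed_complements_bounded[OF real_subspace[OF subT] closed real_subspace[OF subN] closedN sum N(3)])
  have "\<exists>a. x - T a \<in> N" for x
  proof -
    obtain a n where "n \<in> N" "x = T a + n" using sum by blast
    then show ?thesis by (intro exI[of _ a]) simp
  qed
  then obtain g where g: "\<And>x. x - T (g x) \<in> N" by metis
  have uniq: "a = b" if "x - T a \<in> N" "x - T b \<in> N" for a b x
  proof -
    have "T (b - a) \<in> N"
      using subspace_diff[OF subN that] by (simp add: blinfun.diff_right)
    then have "T (b - a) = 0" using N(3) by blast
    then have "\<alpha> * norm (b - a) \<le> 0" using \<alpha>(2)[of "b - a"] by simp
    then show ?thesis using \<alpha>(1) by (simp add: mult_le_0_iff)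
  qed
  have add: "g (x + y) = g x + g y" for x y
  proof (rule uniq[OF g])
    show "x + y - T (g x + g y) \<in> N"
      using subspace_add[OF subN g[of x] g[of y]] by (simp add: blinfun.add_right algebra_simps)
  qed
  have scale: "g (smul c x) = smul c (g x)" for c x
  proof (rule uniq[OF g])
    show "smul c x - T (smul c (g x)) \<in> N"
      using subspace_scale[OF subN g[of x], of c] T(1) by (simp add: bounded_ops_iff scale_right_diff_distrib)
  qed
  have bound: "norm (g x) \<le> norm x * (c / \<alpha>)" for x
  proof -
    have "\<alpha> * norm (g x) \<le> norm (T (g x))" by (rule \<alpha>(2))
    also have "\<dots> \<le> c * norm (T (g x) + (x - T (g x)))" by (intro c[rule_format] g rangeI)
    finally show ?thesis using \<alpha>(1) by (simp add: field_simps)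
  qed
  have "bounded_linear g"
    using scale[of "of_real _"] by (intro bounded_linear_intro[OF add _ bound]) (simp add: scale_of_real)
  then have L: "blinfun_apply (Blinfun g) = g"
    by (rule bounded_linear_Blinfun_apply)
  show ?thesis
  proof (rule that)
    show "Blinfun g \<in> bounded_ops smul" by (simp add: bounded_ops_iff L scale)
    show "Blinfun g o\<^sub>L T = id_blinfun"
    proof (rule blinfun_eqI)
      fix x
      have "g (T x) = x"
        by (rule uniq[OF g]) (simp add: subspace_0[OF subN])
      then show "(Blinfun g o\<^sub>L T) x = id_blinfun x" by (simp add: L)
    qed
  qed
qed

text \<open>
  A vector \<open>x0 \<noteq> 0\<close> on whose multiples \<open>C\<close> acts as \<open>- 1\<close> transfers the compactness of \<open>C\<close> to the
  scalars: along a subsequence the vectors \<open>f (x n) \<cdot> x0\<close> converge, so the scalars \<open>f (x n)\<close> form a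
  Cauchy sequence, and so do the vectors \<open>f (x n) \<cdot> y\<close>.
\<close>

lemma rank_one_compact:
  fixes smul :: "'k::real_normed_field \<Rightarrow> 'a::banach \<Rightarrow> 'a"
  assumes "normed_space smul" and C: "compact_seq C"
    and x0: "x0 \<noteq> 0" "\<And>c. C (smul c x0) = - smul c x0"
  shows "compact_seq (normed_space.rank_one smul f y)"
proof -
  interpret normed_space smul by fact
  show ?thesis
    unfolding compact_seq_def
  proof (intro allI impI)
    fix x :: "nat \<Rightarrow> 'a" assume "bounded (range x)"
    then obtain b where b: "\<And>n. norm (x n) \<le> b"
      unfolding bounded_iff by blast
    have bz: "norm (smul (f (x n)) x0) \<le> norm f * b * norm x0" for n
    proof -
      have "norm (f (x n)) \<le> norm f * norm (x n)" by (rule norm_blinfun)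
      also have "\<dots> \<le> norm f * b" by (intro mult_left_mono b norm_ge_zero)
      finally show ?thesis by (simp add: norm_scale mult_right_mono)
    qed
    obtain r l where r: "strict_mono r" "(\<lambda>n. C (smul (f (x (r n))) x0)) \<longlonglongrightarrow> l"
      by (rule compact_seqE[OF C bz])
    have Cauchy: "Cauchy (\<lambda>n. C (smul (f (x (r n))) x0))"
      using r(2) by (rule LIMSEQ_imp_Cauchy)
    define t where "t = norm y / norm x0"
    have t: "t \<ge> 0" by (simp add: t_def)
    have dist: "dist (smul d y) (smul e y) = t * dist (C (smul d x0)) (C (smul e x0))" for d e
    proof -
      have "dist (C (smul d x0)) (C (smul e x0)) = norm (smul (d - e) x0)"
        by (simp add: x0(2) dist_norm scale_left_diff_distrib norm_minus_commute)
      moreover have "dist (smul d y) (smul e y) = norm (smul (d - e) y)"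
        by (simp add: dist_norm scale_left_diff_distrib)
      ultimately show ?thesis using x0(1) by (simp add: norm_scale t_def)
    qed
    have "Cauchy (\<lambda>n. smul (f (x (r n))) y)"
      unfolding Cauchy_def dist
    proof (intro allI impI)
      fix e :: real assume e: "e > 0"
      then have e': "e / (t + 1) > 0" using t by simp
      obtain k where k: "\<forall>m\<ge>k. \<forall>n\<ge>k. dist (C (smul (f (x (r m))) x0)) (C (smul (f (x (r n))) x0)) < e / (t + 1)"
        using metric_CauchyD[OF Cauchy e'] by (rule exE)
      have "t * q < e" if "0 \<le> q" "q < e / (t + 1)" for q
      proof -
        have "q * (t + 1) < e" using that t by (simp add: field_simps)
        then show ?thesis using that(1) by (simp add: algebra_simps)
      qed
      then show "\<exists>k. \<forall>m\<ge>k. \<forall>n\<ge>k. t * dist (C (smul (f (x (r m))) x0)) (C (smul (f (x (r n))) x0)) < e"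
        using k by (intro exI[of _ k]) simp
    qed
    then have "convergent (\<lambda>n. smul (f (x (r n))) y)"
      by (rule Cauchy_convergent)
    then obtain l' where "(\<lambda>n. smul (f (x (r n))) y) \<longlonglongrightarrow> l'"
      unfolding convergent_def by (rule exE)
    then show "\<exists>r l. strict_mono r \<and> (\<lambda>n. rank_one f y (x (r n))) \<longlonglongrightarrow> l"
      using r(1) by (intro exI[of _ r] exI[of _ l']) simp
  qed
qed

text \<open>
  If \<open>1 + C\<close> kills \<open>x0 \<noteq> 0\<close>, it is not surjective. Take \<open>y\<close> outside its range and a functional \<open>f\<close>
  with \<open>f x0 = 1\<close>. Adding \<open>f x \<cdot> y\<close> shrinks the kernel to its intersection with the kernel of
  \<open>f\<close>, which no longer contains \<open>x0\<close>; the induction is on the dimension of the kernel.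
\<close>

lemma finite_rank_injective_correction:
  fixes smul :: "'k::real_normed_field \<Rightarrow> 'a::banach \<Rightarrow> 'a"
  assumes "normed_space smul" and sep: "normed_space.separating_dual smul"
    and compact: "\<And>f y. f \<in> dual smul \<Longrightarrow> compact_seq (normed_space.rank_one smul f y)"
    and "compact_seq C" "C \<in> bounded_ops smul"
  shows "\<exists>P B. P \<in> bounded_ops smul \<and> compact_seq P \<and> finite B \<and>
    range P \<subseteq> module.span smul B \<and> (\<forall>x. (id_blinfun + (C + P)) x = 0 \<longrightarrow> x = 0)"
  using assms(4,5)
proof (induction "vector_space.dim smul {x. (id_blinfun + C) x = 0}" arbitrary: C rule: less_induct)
  case less
  interpret normed_space smul by fact
  define Z where "Z D = {x. (id_blinfun + D) x = 0}" for D :: "'a \<Rightarrow>\<^sub>L 'a"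
  have subZ: "subspace (Z D)" if "D \<in> bounded_ops smul" for D
  proof -
    have "id_blinfun + D \<in> bounded_ops smul"
      by (intro bounded_ops_intros bounded_ops_id that)
    then show ?thesis
      unfolding subspace_def Z_def by (simp add: bounded_ops_iff blinfun.add_right)
  qed
  show ?case
  proof (cases "\<exists>x0. x0 \<in> Z C \<and> x0 \<noteq> 0")
    case False
    have "compact_seq 0"
      unfolding compact_seq_def by (auto intro!: exI[of _ id] exI[of _ 0] simp: strict_mono_def)
    with False show ?thesis
      by (intro exI[of _ 0] exI[of _ "{}"]) (auto simp: Z_def bounded_ops_zero)
  next
    case True
    then obtain x0 where x0: "x0 \<in> Z C" "x0 \<noteq> 0" by blast
    then have "\<not> surj (blinfun_apply (id_blinfun + C))"
      using surjective_imp_injective[OF less.prems(1) refl, of x0] by (auto simp: Z_def)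
    then obtain y where y: "y \<notin> range (id_blinfun + C)" by blast
    obtain f where f: "f \<in> dual smul" "f x0 = 1"
      using sep x0(2) by (auto simp: separating_dual_def)
    define R where "R = rank_one f y"
    have R: "R \<in> bounded_ops smul" "compact_seq R"
      unfolding R_def using f(1) by (auto intro: rank_one_bounded_ops compact)
    have ZR: "Z (C + R) = {x \<in> Z C. f x = 0}"
    proof -
      have fz: "f x = 0" if "x \<in> Z (C + R)" for x
      proof (rule ccontr)
        assume nz: "f x \<noteq> 0"
        \<comment> \<open>Dividing by \<open>f x\<close> would put \<open>y\<close> into the range of \<open>1 + C\<close>.\<close>
        have "(id_blinfun + C) x + smul (f x) y = 0"
          using that by (simp add: Z_def R_def blinfun.add_left add.assoc)
        then have "smul (f x) y = (id_blinfun + C) (- x)"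
          by (simp add: blinfun.minus_right eq_neg_iff_add_eq_0 add.commute)
        then have "smul (inverse (f x)) (smul (f x) y) = (id_blinfun + C) (smul (inverse (f x)) (- x))"
          using bounded_ops_intros(1)[OF bounded_ops_id less.prems(2)] by (simp only: bounded_ops_iff)
        then have "y = (id_blinfun + C) (smul (inverse (f x)) (- x))"
          using nz by simp
        with y show False by blast
      qed
      have "x \<in> Z (C + R) \<longleftrightarrow> x \<in> Z C" if "f x = 0" for x
        by (simp add: Z_def R_def blinfun.add_left that)
      with fz show ?thesis by blast
    qed
    obtain B0 where B0: "finite B0" "Z C \<subseteq> Real_Vector_Spaces.span B0"
      using kernel_finite_dim[OF less.prems(1) refl] unfolding Z_def by (elim exE conjE)
    have CR: "C + R \<in> bounded_ops smul" "compact_seq (C + R)"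
      by (intro bounded_ops_intros compact_seq_add less.prems R)+
    have "dim (Z (C + R)) < dim (Z C)"
    proof (rule dim_less)
      show "Z (C + R) \<subseteq> Z C" "x0 \<notin> Z (C + R)"
        using f(2) by (auto simp: ZR)
      show "Z C \<subseteq> span B0"
        using B0(2) real_span_subset by (rule order_trans)
    qed (use x0 B0 CR subZ in auto)
    then obtain P B where P: "P \<in> bounded_ops smul" "compact_seq P" "finite B" "range P \<subseteq> span B"
        "\<forall>x. (id_blinfun + ((C + R) + P)) x = 0 \<longrightarrow> x = 0"
      using less.hyps[OF _ CR(2,1)] unfolding Z_def by (elim meta_impE exE conjE)
    show ?thesis
    proof (intro exI conjI)
      show "R + P \<in> bounded_ops smul" "compact_seq (R + P)"
        by (intro bounded_ops_intros compact_seq_add R P)+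
      show "finite (insert y B)" using P(3) by simp
      show "range (R + P) \<subseteq> span (insert y B)"
      proof clarify
        fix x
        have "P x \<in> span (insert y B)"
          using P(4) span_mono[of B "insert y B"] by blast
        then show "(R + P) x \<in> span (insert y B)"
          by (simp add: R_def blinfun.add_left span_add span_scale span_base)
      qed
      show "\<forall>x. (id_blinfun + (C + (R + P))) x = 0 \<longrightarrow> x = 0"
        using P(5) by (simp only: add.assoc)
    qed
  qed
qed

lemma injective_compact_perturbation_left_inverse:
  fixes smul :: "'k::real_normed_field \<Rightarrow> 'a::banach \<Rightarrow> 'a"
  assumes "normed_space smul" and C: "compact_seq C" "C \<in> bounded_ops smul"
    and inj: "\<And>x. (id_blinfun + C) x = 0 \<Longrightarrow> x = 0"
  obtains V where "V \<in> bounded_ops smul" "V o\<^sub>L (id_blinfun + C) = id_blinfun"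
proof -
  interpret normed_space smul by fact
  define U where "U = id_blinfun + C"
  have U: "U \<in> bounded_ops smul"
    unfolding U_def by (intro bounded_ops_intros bounded_ops_id C)
  have injU: "U x = 0 \<Longrightarrow> x = 0" for x
    unfolding U_def by (rule inj)
  obtain a where a: "a > 0" "\<forall>x. a * norm x \<le> norm (U x)"
    by (rule injective_bounded_below[OF C(1) U_def injU])
  define g where "g = inv (blinfun_apply U)"
  have g: "U (g y) = y" for y
    unfolding g_def by (rule surj_f_inv_f[OF injective_imp_surjective[OF C(1) U_def injU]])
  have uniq: "x = x'" if "U x = U x'" for x x'
    using injU[of "x - x'"] that by (simp add: blinfun.diff_right)
  have scale: "g (smul c x) = smul c (g x)" for c x
    by (rule uniq) (use U in \<open>simp add: g bounded_ops_iff\<close>)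
  have bound: "norm (g x) \<le> norm x * (1 / a)" for x
    using a(2)[rule_format, of "g x"] a(1) by (simp add: g field_simps)
  have add: "g (x + y) = g x + g y" for x y
    by (rule uniq) (simp add: g blinfun.add_right)
  have "bounded_linear g"
    using scale[of "of_real _"] by (intro bounded_linear_intro[OF add _ bound]) (simp add: scale_of_real)
  then have V: "blinfun_apply (Blinfun g) = g"
    by (rule bounded_linear_Blinfun_apply)
  show ?thesis
  proof (rule that)
    show "Blinfun g \<in> bounded_ops smul" by (simp add: bounded_ops_iff V scale)
    show "Blinfun g o\<^sub>L (id_blinfun + C) = id_blinfun"
      unfolding U_def[symmetric] by (rule blinfun_eqI, rule uniq) (simp add: V g)
  qed
qed

text \<open>
  An operator that is left invertible modulo compact operators has an inner inverse. If \<open>1 + C\<close> is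
  injective, it is invertible and \<open>A\<close> has a genuine left inverse. Otherwise a kernel vector makes
  functionals and finite-rank corrections available.
\<close>

lemma inner_invertible_left_inverse_mod_compact:
  fixes smul :: "'k::real_normed_field \<Rightarrow> 'a::banach \<Rightarrow> 'a"
  assumes "normed_space smul" and A: "A \<in> bounded_ops smul" and L: "L \<in> bounded_ops smul"
    and C: "compact_seq C" "C \<in> bounded_ops smul" and LA: "L o\<^sub>L A = id_blinfun + C"
  shows "normed_space.inner_invertible smul A"
proof -
  interpret normed_space smul by fact
  define U where "U = id_blinfun + C"
  have Ux: "U x = x + C x" for x
    by (simp add: U_def blinfun.add_left)
  show ?thesis
  proof (cases "\<forall>x. U x = 0 \<longrightarrow> x = 0")
    case True
    obtain V where V: "V \<in> bounded_ops smul" "V o\<^sub>L (id_blinfun + C) = id_blinfun"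
      by (rule injective_compact_perturbation_left_inverse[OF assms(1) C])
        (use True in \<open>simp_all add: U_def\<close>)
    have "(V o\<^sub>L (L o\<^sub>L A)) x = x" for x
      unfolding LA V(2) by simp
    then have "A o\<^sub>L (V o\<^sub>L L) o\<^sub>L A = A"
      by (intro blinfun_eqI) simp
    then show ?thesis
      unfolding inner_invertible_def using bounded_ops_intros(3)[OF V(1) L] by blast
  next
    case False
    then obtain x0 where x0: "U x0 = 0" "x0 \<noteq> 0" by blast
    have "smul c x0 + smul c (C x0) = 0" for c
      using x0(1) by (simp add: Ux flip: scale_right_distrib)
    then have Cx0: "C (smul c x0) = - smul c x0" for c
      using C(2) by (simp add: bounded_ops_iff eq_neg_iff_add_eq_0 add.commute)
    obtain B where B: "finite B" "{x. U x = 0} \<subseteq> Real_Vector_Spaces.span B"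
      using kernel_finite_dim[OF C(1) U_def] by (elim exE conjE)
    have "range (\<lambda>c. smul c x0) \<subseteq> Real_Vector_Spaces.span B"
      using B(2) by (auto simp: Ux Cx0)
    then obtain Bk :: "'k set" where "finite Bk" "\<not> Real_Vector_Spaces.dependent Bk"
        "Real_Vector_Spaces.span Bk = UNIV"
      by (rule scalars_finite_dim[OF x0(2) B(1)])
    then have sep: separating_dual
      by (rule separating_dual_finite_dim_scalars)
    obtain P BP where P: "P \<in> bounded_ops smul" "compact_seq P" "finite BP" "range P \<subseteq> span BP"
        "\<forall>x. (id_blinfun + (C + P)) x = 0 \<longrightarrow> x = 0"
      using finite_rank_injective_correction[OF assms(1) sep rank_one_compact[OF assms(1) C(1) x0(2) Cx0] C]
      by (elim exE conjE)
    obtain V where V: "V \<in> bounded_ops smul" "V o\<^sub>L (id_blinfun + (C + P)) = id_blinfun"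
      by (rule injective_compact_perturbation_left_inverse[OF assms(1) compact_seq_add[OF C(1) P(2)]
            bounded_ops_intros(1)[OF C(2) P(1)]]) (use P(5) in simp_all)
    have VU: "V (L (A x)) = x - V (P x)" for x
    proof -
      have "(V o\<^sub>L (id_blinfun + (C + P))) x = x"
        unfolding V(2) by simp
      moreover have "L (A x) = x + C x"
        using LA[THEN arg_cong, of "\<lambda>F. blinfun_apply F x"] by (simp add: blinfun.add_left)
      ultimately show ?thesis
        by (simp add: blinfun.add_left blinfun.add_right algebra_simps)
    qed
    define W where "W = A - (A o\<^sub>L (V o\<^sub>L L) o\<^sub>L A)"
    have Wx: "W x = A (V (P x))" for x
      by (simp add: W_def blinfun.diff_left VU blinfun.diff_right)
    have W: "W \<in> bounded_ops smul"
      unfolding W_def by (intro bounded_ops_intros A V L)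
    have AV: "module_hom smul smul (A o\<^sub>L V)"
      using bounded_ops_intros(3)[OF A V(1)] by (simp add: bounded_ops_def Vector_Spaces.linear_def)
    have "range W = (A o\<^sub>L V) ` range P"
      by (auto simp: Wx)
    also have "\<dots> \<subseteq> (A o\<^sub>L V) ` span BP"
      using P(4) by (rule image_mono)
    also have "\<dots> = span ((A o\<^sub>L V) ` BP)"
      by (rule module_hom.span_image[OF AV, symmetric])
    finally have "inner_invertible W"
      by (rule finite_rank_inner_invertible[OF sep W finite_imageI[OF P(3)]])
    then show ?thesis
      unfolding W_def by (rule inner_invertible_remainder[OF A bounded_ops_intros(3)[OF V(1) L]])
  qed
qed

section \<open>Perturbing an operator that is bounded below\<close>

theorem corollary5p2:
  fixes smul :: "'k::real_normed_field \<Rightarrow> 'a::banach \<Rightarrow> 'a"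
    and T K :: "'a \<Rightarrow>\<^sub>L 'a"
  assumes "normed_space smul"
    and "T \<in> bounded_ops smul"
    and "K \<in> bounded_ops smul"
    and "bounded_below T"
    and "complemented smul UNIV (closure (range (blinfun_apply T)))"
    and "compact_operator K"
  defines "S \<equiv> blinfun_apply (T + K)"
    and "S' \<equiv> (\<lambda>f :: 'a \<Rightarrow>\<^sub>L 'k. normed_adjoint T f + normed_adjoint K f)"
  shows "complemented smul UNIV (closure (range S)) \<and>
    complemented smul UNIV (kernel_on UNIV S) \<and>
    complemented dual_scale (dual smul) (top_of_set (dual smul) closure_of (S' ` dual smul)) \<and>
    complemented dual_scale (dual smul) (kernel_on (dual smul) S') \<and>
    closed (range S) \<and>
    closedin (top_of_set (dual smul)) (S' ` dual smul)"
proof -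
  interpret normed_space smul by fact
  interpret dual: normed_space "dual_scale :: 'k \<Rightarrow> ('a \<Rightarrow>\<^sub>L 'k) \<Rightarrow> _"
    by (rule normed_space_dual_scale)
  define A where "A = T + K"
  have A: "A \<in> bounded_ops smul"
    unfolding A_def using assms(2,3) by (rule bounded_ops_intros)
  obtain L where L: "L \<in> bounded_ops smul" "L o\<^sub>L T = id_blinfun"
    using bounded_below_left_inverse[OF assms(1,2,4,5)] .
  have "compact_seq (L o\<^sub>L K)"
    by (intro compact_seq_compose compact_operator_imp_compact_seq assms(6))
  moreover have "L o\<^sub>L A = id_blinfun + (L o\<^sub>L K)"
    unfolding A_def L(2)[symmetric]
    by (intro blinfun_eqI) (simp add: blinfun.add_left blinfun.add_right)
  ultimately have "inner_invertible A"
    using bounded_ops_intros(3)[OF L(1) assms(3)]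
    by (intro inner_invertible_left_inverse_mod_compact[OF assms(1) A L(1)])
  then obtain D where D: "D \<in> bounded_ops smul" "A o\<^sub>L D o\<^sub>L A = A"
    by (auto simp: inner_invertible_def)
  have ADA: "A (D (A x)) = A x" for x
    using D(2)[THEN arg_cong, of "\<lambda>F. blinfun_apply F x"] by simp

  have Y: "closed_subspace smul UNIV UNIV"
    by (simp add: closed_subspace_def)
  have lin: "Vector_Spaces.linear smul smul (blinfun_apply F)" if "F \<in> bounded_ops smul" for F
    using that by (simp add: bounded_ops_def)
  have cont: "continuous_on UNIV (blinfun_apply F)" for F :: "'a \<Rightarrow>\<^sub>L 'a"
    by (intro continuous_intros)
  have "range (A o\<^sub>L D) = range A"
    using ADA by (auto simp: image_iff) metis
  then have range: "complemented smul UNIV (range S)"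
    unfolding S_def A_def[symmetric]
    using complemented_projection(1)[OF assms(1) Y lin[OF bounded_ops_intros(3)[OF A D(1)]] cont]
    by (simp add: ADA)
  have "kernel_on UNIV (D o\<^sub>L A) = kernel_on UNIV A"
    using ADA by (auto simp: kernel_on_def) (metis blinfun.zero_right)
  then have kernel: "complemented smul UNIV (kernel_on UNIV S)"
    unfolding S_def A_def[symmetric]
    using complemented_projection(2)[OF assms(1) Y lin[OF bounded_ops_intros(3)[OF D(1) A]] cont]
    by (simp add: ADA)
  have closed: "closed (range S)"
    using range by (simp add: complemented_def closed_subspace_def)

  have S': "S' f = f o\<^sub>L A" for f
    unfolding S'_def normed_adjoint_def A_def
    by (intro blinfun_eqI) (simp add: blinfun.add_left blinfun.add_right)
  have comp_dual: "f o\<^sub>L F \<in> dual smul" if "f \<in> dual smul" "F \<in> bounded_ops smul" for f F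
    using normed_adjoint_dual[OF that(2,1)] by (simp add: normed_adjoint_def)
  have linD: "Vector_Spaces.linear dual_scale dual_scale (\<lambda>f :: 'a \<Rightarrow>\<^sub>L 'k. f o\<^sub>L F)" for F :: "'a \<Rightarrow>\<^sub>L 'a"
    by (auto simp: dual.linear_iff[OF normed_space_dual_scale] blinfun.add_left intro!: blinfun_eqI)
  have contD: "continuous_on UNIV (\<lambda>f :: 'a \<Rightarrow>\<^sub>L 'k. f o\<^sub>L F)" for F :: "'a \<Rightarrow>\<^sub>L 'a"
    by (intro linear_continuous_on bounded_bilinear.bounded_linear_left[OF bounded_bilinear_blinfun_compose])
  note projD = complemented_projection[OF normed_space_dual_scale closed_subspace_dual linD contD]
  have DA: "D o\<^sub>L A \<in> bounded_ops smul" and AD: "A o\<^sub>L D \<in> bounded_ops smul"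
    by (intro bounded_ops_intros A D(1))+
  have ADA1: "f o\<^sub>L A o\<^sub>L (D o\<^sub>L A) = f o\<^sub>L A" and ADA2: "f o\<^sub>L (A o\<^sub>L D) o\<^sub>L A = f o\<^sub>L A"
    and ADA3: "f o\<^sub>L (D o\<^sub>L A) o\<^sub>L (D o\<^sub>L A) = f o\<^sub>L (D o\<^sub>L A)"
    and ADA4: "f o\<^sub>L (A o\<^sub>L D) o\<^sub>L (A o\<^sub>L D) = f o\<^sub>L (A o\<^sub>L D)"
    and assoc: "f o\<^sub>L (D o\<^sub>L A) = f o\<^sub>L D o\<^sub>L A" "f o\<^sub>L (A o\<^sub>L D) = f o\<^sub>L A o\<^sub>L D" for f :: "'a \<Rightarrow>\<^sub>L 'k"
    by (intro blinfun_eqI; simp add: ADA)+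
  have image: "(\<lambda>f. f o\<^sub>L (D o\<^sub>L A)) ` dual smul = S' ` dual smul"
  proof (intro antisym image_subsetI)
    fix f assume f: "f \<in> dual smul"
    have "S' (f o\<^sub>L D) \<in> S' ` dual smul"
      by (intro imageI comp_dual f D(1))
    then show "f o\<^sub>L (D o\<^sub>L A) \<in> S' ` dual smul"
      by (simp only: S' assoc)
    show "S' f \<in> (\<lambda>f. f o\<^sub>L (D o\<^sub>L A)) ` dual smul"
    proof (rule image_eqI)
      show "S' f = f o\<^sub>L A o\<^sub>L (D o\<^sub>L A)" by (simp only: S' ADA1)
    qed (intro comp_dual f A)
  qed
  have range': "complemented dual_scale (dual smul) (S' ` dual smul)"
    unfolding image[symmetric]
    by (rule projD(1)) (simp_all add: ADA3 image_subset_iff comp_dual[OF _ DA])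
  have kernel_eq: "kernel_on (dual smul) (\<lambda>f. f o\<^sub>L (A o\<^sub>L D)) = kernel_on (dual smul) S'"
  proof -
    have "f o\<^sub>L A = 0" if "f o\<^sub>L (A o\<^sub>L D) = 0" for f :: "'a \<Rightarrow>\<^sub>L 'k"
      using ADA2[of f] by (simp add: that)
    moreover have "f o\<^sub>L (A o\<^sub>L D) = 0" if "f o\<^sub>L A = 0" for f :: "'a \<Rightarrow>\<^sub>L 'k"
      by (simp add: assoc that)
    ultimately show ?thesis
      by (auto simp: kernel_on_def S')
  qed
  have kernel': "complemented dual_scale (dual smul) (kernel_on (dual smul) S')"
    unfolding kernel_eq[symmetric]
    by (rule projD(2)) (simp_all add: ADA4 image_subset_iff comp_dual[OF _ AD])
  have closed': "closedin (top_of_set (dual smul)) (S' ` dual smul)"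
    using range' by (simp add: complemented_def closed_subspace_def)
  show ?thesis
    using range kernel range' kernel' closed closed'
    by (simp add: closure_closed closure_of_closedin)
qed

end
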